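(* Let $n\ge 8$ with $n=p$ or $n=p+1$ for a prime $p$, and let $\widetilde\Delta_n$ be the connected component of $\widetilde P_0(S_n)$ containing $[(1\,2)]$. Then: (i) $\widetilde P_0(S_n)$ consists of $\widetilde\Delta_n$, which contains $[\psi]$ for every $\psi\in S_n\setminus\{\mathrm{id}\}$ that is not a $p$-cycle, together with $(n-2)!$ (if $n=p$) or $n(n-3)!$ (if $n=p+1$) further components, each an isolated vertex; (ii) $P_0(S_n)$ consists of the component induced on $\{\psi\in S_n\setminus\{\mathrm{id}\}:[\psi]\in V(\widetilde\Delta_n)\}$, which contains every non-identity permutation other than the $p$-cycles, together with $(n-2)!$ (resp. $n(n-3)!$) further components, each consisting of $p-1$ $p$-cycles forming a complete graph; (iii) $P_0(\mathcal T(S_n))$ consists of the component whose vertex set is $\{T_\psi:[\psi]\in V(\widetilde\Delta_n)\}$, which contains $T_\psi$ for every non-identity $\psi$ that is not a $p$-cycle, together with the isolated vertex $[p]$ (if $n=p$) or $[1,p]$ (if $n=p+1$); (iv) $\mathcal O_0(S_n)$ consists of the component with vertex set $\{o(\psi):[\psi]\in V(\widetilde\Delta_n)\}$, which contains the order of every non-identity permutation of order other than $p$, together with the isolated vertex $p$. Moreover, in each of (i)-(iv) the large (main) component is not a complete graph.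
   Context: $P_0(G)$: vertex set $G\setminus\{1\}$, distinct $x,y$ adjacent iff one is a positive power of the other. $\widetilde P_0(G)$: vertex set $\{[x]:x\ne 1\}$ with $[x]=\{y:\langle y\rangle=\langle x\rangle\}$, distinct $[x],[y]$ adjacent iff some representatives are one a positive power of the other. $\mathcal O_0(G)$: vertices the element orders $\ne 1$, distinct $m,m'$ adjacent iff one divides the other. For $\psi\in S_n$, the type $T_\psi$ is the partition of $n$ given by orbit lengths of $\langle\psi\rangle$ on $\{1,\dots,n\}$; a $p$-cycle has type $[1^{n-p},p]$. For a partition $T=[m_1^{t_1},\dots,m_k^{t_k}]$, $T^a=[(m_i/\gcd(a,m_i))^{t_i\gcd(a,m_i)}]_i$. $P_0(\mathcal T(S_n))$: vertices the partitions of $n$ other than $[1^n]$, distinct $T,T'$ adjacent iff one is a power of the other. *)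

theory Defs
  imports "HOL-Combinatorics.Combinatorics" "HOL-Library.Multiset" "HOL-Computational_Algebra.Primes"
begin

definition adj :: "'a set \<Rightarrow> ('a \<Rightarrow> 'a \<Rightarrow> bool) \<Rightarrow> 'a \<Rightarrow> 'a \<Rightarrow> bool" where
  "adj V E x y \<longleftrightarrow> x \<in> V \<and> y \<in> V \<and> x \<noteq> y \<and> E x y"

text \<open>connected component of a vertex x (meant for x in V)\<close>
definition component_of :: "'a set \<Rightarrow> ('a \<Rightarrow> 'a \<Rightarrow> bool) \<Rightarrow> 'a \<Rightarrow> 'a set" where
  "component_of V E x = {y. (adj V E)\<^sup>*\<^sup>* x y}"

definition components :: "'a set \<Rightarrow> ('a \<Rightarrow> 'a \<Rightarrow> bool) \<Rightarrow> 'a set set" where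
  "components V E = component_of V E ` V"

definition complete_on :: "'a set \<Rightarrow> ('a \<Rightarrow> 'a \<Rightarrow> bool) \<Rightarrow> bool" where
  "complete_on C E \<longleftrightarrow> (\<forall>x\<in>C. \<forall>y\<in>C. x \<noteq> y \<longrightarrow> E x y)"

definition Sn :: "nat \<Rightarrow> (nat \<Rightarrow> nat) set" where
  "Sn n = {f. f permutes {1..n}}"

definition ppow :: "(nat \<Rightarrow> nat) \<Rightarrow> (nat \<Rightarrow> nat) \<Rightarrow> bool" where
  "ppow x y \<longleftrightarrow> (\<exists>k\<ge>1. y = x ^^ k)"

definition cyc :: "(nat \<Rightarrow> nat) \<Rightarrow> (nat \<Rightarrow> nat) set" where
  "cyc x = {x ^^ k | k. True}"

definition cls :: "nat \<Rightarrow> (nat \<Rightarrow> nat) \<Rightarrow> (nat \<Rightarrow> nat) set" where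
  "cls n x = {y \<in> Sn n. cyc y = cyc x}"

definition perm_ord :: "(nat \<Rightarrow> nat) \<Rightarrow> nat" where
  "perm_ord f = (LEAST k. 0 < k \<and> f ^^ k = id)"

definition orbits :: "nat \<Rightarrow> (nat \<Rightarrow> nat) \<Rightarrow> nat set set" where
  "orbits n f = (\<lambda>i. {(f ^^ k) i | k. True}) ` {1..n}"

definition cycle_type :: "nat \<Rightarrow> (nat \<Rightarrow> nat) \<Rightarrow> nat multiset" where
  "cycle_type n f = image_mset card (mset_set (orbits n f))"

definition is_pcycle :: "nat \<Rightarrow> nat \<Rightarrow> (nat \<Rightarrow> nat) \<Rightarrow> bool" where
  "is_pcycle n p f \<longleftrightarrow> cycle_type n f = replicate_mset (n - p) 1 + {#p#}"

definition partitions :: "nat \<Rightarrow> nat multiset set" where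
  "partitions n = {T. (\<forall>m\<in>#T. 0 < m) \<and> sum_mset T = n}"

definition ppower :: "nat multiset \<Rightarrow> nat \<Rightarrow> nat multiset" where
  "ppower T a = sum_mset (image_mset (\<lambda>m. replicate_mset (gcd a m) (m div gcd a m)) T)"

definition PV :: "nat \<Rightarrow> (nat \<Rightarrow> nat) set" where
  "PV n = Sn n - {id}"
definition PE :: "(nat \<Rightarrow> nat) \<Rightarrow> (nat \<Rightarrow> nat) \<Rightarrow> bool" where
  "PE x y \<longleftrightarrow> ppow x y \<or> ppow y x"

definition QV :: "nat \<Rightarrow> (nat \<Rightarrow> nat) set set" where
  "QV n = cls n ` (Sn n - {id})"
definition QE :: "(nat \<Rightarrow> nat) set \<Rightarrow> (nat \<Rightarrow> nat) set \<Rightarrow> bool" where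
  "QE X Y \<longleftrightarrow> (\<exists>x\<in>X. \<exists>y\<in>Y. ppow x y \<or> ppow y x)"

definition TV :: "nat \<Rightarrow> nat multiset set" where
  "TV n = partitions n - {replicate_mset n 1}"
definition TE :: "nat multiset \<Rightarrow> nat multiset \<Rightarrow> bool" where
  "TE T T' \<longleftrightarrow> (\<exists>a\<ge>1. T' = ppower T a \<or> T = ppower T' a)"

definition OV :: "nat \<Rightarrow> nat set" where
  "OV n = perm_ord ` (Sn n - {id}) - {1}"
definition OE :: "nat \<Rightarrow> nat \<Rightarrow> bool" where
  "OE m m' \<longleftrightarrow> m dvd m' \<or> m' dvd m"

definition Delta :: "nat \<Rightarrow> (nat \<Rightarrow> nat) set set" where
  "Delta n = component_of (QV n) QE (cls n (Transposition.transpose 1 2))"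

end

theory Submission
  imports Defs "HOL-Number_Theory.Cong"
begin

text \<open>Commuting permutations of coprime orders are both powers of their product, so they lie in the
  same component of the power graph. Since \<open>p \<le> n \<le> p + 1\<close>, an element whose order is divisible by
  \<open>p\<close> is a \<open>p\<close>-cycle; any other non-identity element has a power of prime order \<open>q \<le> n - 2\<close>,
  from which at most four such commuting steps lead to a transposition: two fixed points of an element
  of odd order carry a transposition, two \<open>q\<close>-cycles are swapped by an involution, and an involution
  commutes with an element of order 3 having two fixed points or fixes the points of a 3-cycle.
  The other three graphs are images of the power graph under maps that keep adjacent vertices of
  comparable order, so the separation of the \<open>p\<close>-cycles, which only depends on orders, passes to them.
  The \<open>p\<close>-cycles are counted by lists of \<open>p\<close> distinct points.\<close>

section \<open>Orders and powers\<close>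

text \<open>The bound 8 comes from the tightest step: an involution with three 2-cycles is linked to
  an element of order 3 moving six points, and two further points must stay fixed. Joining two
  transpositions by a disjoint 3-cycle takes only seven points. The bound
  \<open>q \<le> n - 2\<close> is a matter of parity. If \<open>n = p\<close>, then
  \<open>n - 1\<close> is even; if \<open>n = p + 1\<close>, then \<open>n\<close> is even and
  \<open>n - 1\<close> is \<open>p\<close> itself. So an odd prime \<open>q \<le> n\<close> other
  than \<open>p\<close> is at most \<open>n - 2\<close>. The closeness of \<open>n\<close> and
  \<open>p\<close> also gives the count: as \<open>n - p\<close> is 0 or 1, there are
  \<open>n!\<close> lists of \<open>p\<close> distinct points. Each \<open>p\<close>-cycle comes
  from \<open>p\<close> of them and each subgroup of order \<open>p\<close> contains
  \<open>p - 1\<close> generators, so there are \<open>n!\<close> divided by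
  \<open>p (p - 1)\<close> subgroups, which is \<open>(n - 2)!\<close> or \<open>n (n - 3)!\<close>.
  In all four graphs (1 2) and (1 2 3) witness that the main component is not complete: neither of
  the orders 2 and 3 divides the other.\<close>

lemma Sn_permutation: "x \<in> Sn n \<Longrightarrow> permutation x"
  unfolding Sn_def permutation_permutes by (auto intro: finite_atLeastAtMost)

lemma Sn_funpow: "x \<in> Sn n \<Longrightarrow> x ^^ k \<in> Sn n"
  unfolding Sn_def by (auto intro: permutes_funpow)

lemma Sn_comp: "x \<in> Sn n \<Longrightarrow> y \<in> Sn n \<Longrightarrow> x \<circ> y \<in> Sn n"
  unfolding Sn_def by (auto intro: permutes_compose)

lemma Sn_inj: "x \<in> Sn n \<Longrightarrow> inj x"
  unfolding Sn_def by (auto intro: permutes_inj)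

lemma finite_Sn: "finite (Sn n)"
  unfolding Sn_def by (rule finite_permutations) simp

lemma perm_ord_pow_eq_id:
  assumes "x \<in> Sn n"
  shows "perm_ord x > 0" "x ^^ perm_ord x = id"
proof -
  obtain k where "x ^^ k = id" "k > 0"
    using permutation_is_nilpotent[OF Sn_permutation[OF assms]] by blast
  then have "\<exists>k. 0 < k \<and> x ^^ k = id" by blast
  from LeastI_ex[OF this] show "perm_ord x > 0" "x ^^ perm_ord x = id"
    by (auto simp: perm_ord_def)
qed

lemma funpow_mod_of_id:
  assumes "f ^^ m = id"
  shows "f ^^ k = f ^^ (k mod m)"
proof -
  have "f ^^ k = (f ^^ m) ^^ (k div m) \<circ> f ^^ (k mod m)"
    unfolding funpow_mult funpow_add[symmetric] by simp
  then show ?thesis using assms by simp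
qed

text \<open>If \<open>x ^^ k = id\<close>, the remainder of \<open>k\<close> modulo the order is a
  smaller exponent with the same property, hence 0. Orders are often identified below by comparing
  their multiples through this equivalence.\<close>

lemma perm_ord_dvd_iff:
  assumes "x \<in> Sn n"
  shows "perm_ord x dvd k \<longleftrightarrow> x ^^ k = id"
proof
  assume "perm_ord x dvd k"
  then obtain j where "k = perm_ord x * j" by blast
  then show "x ^^ k = id"
    using perm_ord_pow_eq_id(2)[OF assms] by (simp add: funpow_mult[symmetric])
next
  assume k: "x ^^ k = id"
  have "k mod perm_ord x = 0"
  proof (rule ccontr)
    assume "k mod perm_ord x \<noteq> 0"
    moreover have "x ^^ (k mod perm_ord x) = id"
      using k funpow_mod_of_id[OF perm_ord_pow_eq_id(2)[OF assms]] by metis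
    ultimately have "perm_ord x \<le> k mod perm_ord x"
      unfolding perm_ord_def by (intro Least_le) auto
    then show False using perm_ord_pow_eq_id(1)[OF assms]
      by (meson mod_less_divisor not_le)
  qed
  then show "perm_ord x dvd k" by blast
qed

lemma perm_ord_funpow_dvd:
  assumes x: "x \<in> Sn n"
  shows "perm_ord (x ^^ k) dvd perm_ord x"
proof -
  have "(x ^^ k) ^^ perm_ord x = (x ^^ perm_ord x) ^^ k"
    unfolding funpow_mult by (subst mult.commute) (rule refl)
  then show ?thesis
    by (simp add: perm_ord_dvd_iff[OF Sn_funpow[OF x]] perm_ord_pow_eq_id[OF x])
qed

lemma perm_ord_eq_1: "x \<in> Sn n \<Longrightarrow> perm_ord x = 1 \<longleftrightarrow> x = id"
  using perm_ord_dvd_iff[of x n 1] by auto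

lemma perm_ord_prime:
  assumes "x \<in> Sn n" "prime q" "x ^^ q = id" "x \<noteq> id"
  shows "perm_ord x = q"
  using assms perm_ord_dvd_iff[of x n q] perm_ord_eq_1 by (auto simp: prime_nat_iff)

lemma cyc_eqD:
  assumes "cyc y = cyc x"
  obtains k where "y = x ^^ k"
proof -
  have "y ^^ 1 \<in> cyc y" unfolding cyc_def by blast
  then show ?thesis using assms that by (auto simp: cyc_def)
qed

lemma cyc_eq_perm_ord:
  assumes "x \<in> Sn n" "y \<in> Sn n" "cyc y = cyc x"
  shows "perm_ord y = perm_ord x"
  using assms perm_ord_funpow_dvd cyc_eqD dvd_antisym by metis

text \<open>The exponent \<open>j\<close> is an inverse of \<open>k\<close> modulo
  \<open>q\<close>.\<close>

lemma funpow_coprime_generates: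
  assumes x: "x ^^ q = id" and "prime q" and k: "\<not> q dvd k"
  obtains j where "j \<ge> 1" "(x ^^ k) ^^ j = x"
proof -
  have "coprime q k" using assms by (intro prime_imp_coprime)
  then have "coprime k q" by (rule coprime_commute[THEN iffD1])
  then obtain j where "[k * j = 1] (mod q)"
    using cong_solve_coprime_nat[of k q] by auto
  then have "k * j mod q = 1" using prime_gt_1_nat[OF \<open>prime q\<close>] by (simp add: cong_def)
  then have j: "(x ^^ k) ^^ j = x"
    using funpow_mod_of_id[OF x, of "k * j"] by (simp add: funpow_mult)
  have "j \<noteq> 0" using \<open>k * j mod q = 1\<close> by (intro notI) simp
  then show ?thesis using that[OF _ j] by simp
qed

text \<open>A group of prime order has no proper non-trivial subgroup, so each of its
  \<open>q - 1\<close> non-identity elements generates it.\<close>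

lemma cls_prime_order:
  assumes x: "x \<in> Sn n" and "prime q" "perm_ord x = q"
  shows "cls n x = (\<lambda>k. x ^^ k) ` {1..<q}" "card (cls n x) = q - 1"
proof -
  have xq: "x ^^ q = id" using perm_ord_pow_eq_id x assms(3) by metis
  have neq: "x ^^ k \<noteq> id" if "k \<in> {1..<q}" for k
    using that perm_ord_dvd_iff[OF x, of k] assms(3) by (auto dest: dvd_imp_le)
  show eq: "cls n x = (\<lambda>k. x ^^ k) ` {1..<q}"
  proof (intro equalityI subsetI)
    fix y assume "y \<in> cls n x"
    then have y: "y \<in> Sn n" "cyc y = cyc x" by (auto simp: cls_def)
    then obtain k where k: "y = x ^^ k" by (elim cyc_eqD)
    then have k': "y = x ^^ (k mod q)" using funpow_mod_of_id[OF xq] by simp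
    have "perm_ord y \<noteq> 1" using cyc_eq_perm_ord[OF x y] assms prime_gt_1_nat by auto
    then have "y \<noteq> id" using perm_ord_eq_1[OF y(1)] by simp
    then have "k mod q \<noteq> 0" using k' by (intro notI) simp
    then show "y \<in> (\<lambda>k. x ^^ k) ` {1..<q}" using k' prime_gt_0_nat[OF assms(2)]
      by (intro image_eqI[of _ _ "k mod q"]) auto
  next
    fix y assume "y \<in> (\<lambda>k. x ^^ k) ` {1..<q}"
    then obtain k where k: "y = x ^^ k" "k \<in> {1..<q}" by blast
    then have "\<not> q dvd k" by (auto dest: dvd_imp_le)
    then obtain j where j: "(x ^^ k) ^^ j = x"
      using funpow_coprime_generates[OF xq assms(2)] by metis
    have "cyc y = cyc x"
    proof (intro equalityI subsetI)
      fix z assume "z \<in> cyc y" then show "z \<in> cyc x" by (auto simp: cyc_def k funpow_mult)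
    next
      fix z assume "z \<in> cyc x"
      then obtain i where "z = x ^^ i" by (auto simp: cyc_def)
      then have "z = y ^^ (j * i)" using j k(1) by (simp flip: funpow_mult)
      then show "z \<in> cyc y" by (auto simp: cyc_def)
    qed
    then show "y \<in> cls n x" using k Sn_funpow[OF x] by (auto simp: cls_def)
  qed
  have "inj_on (\<lambda>k. x ^^ k) {1..<q}"
  proof (rule linorder_inj_onI)
    fix i j assume ij: "i < j" "i \<in> {1..<q}" "j \<in> {1..<q}"
    show "x ^^ i \<noteq> x ^^ j"
    proof
      assume *: "x ^^ i = x ^^ j"
      have "x ^^ (j - i) = id"
      proof
        fix a show "(x ^^ (j - i)) a = id a"
          using funpow_diff[OF Sn_inj[OF x], of i j a] * ij by simp
      qed
      moreover have "j - i \<in> {1..<q}" using ij by (simp, linarith)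
      ultimately show False using neq by blast
    qed
  qed auto
  then show "card (cls n x) = q - 1" by (simp add: eq card_image)
qed

section \<open>Cycle types\<close>

lemma least_power_permutes_pos: "x \<in> Sn n \<Longrightarrow> least_power x i > 0"
  by (rule least_power_of_permutation(2)[OF Sn_permutation])

lemma least_power_dvd_iff: "x \<in> Sn n \<Longrightarrow> least_power x i dvd k \<longleftrightarrow> (x ^^ k) i = i"
  by (rule least_power_dvd) (rule Sn_permutation)

lemma card_orbit: "x \<in> Sn n \<Longrightarrow> card {(x ^^ k) i | k. True} = least_power x i"
proof -
  assume x: "x \<in> Sn n"
  have "{(x ^^ k) i | k. True} = set (support x i)"
    unfolding support_set[OF Sn_permutation[OF x]] by auto
  moreover have "card (set (support x i)) = length (support x i)"
    by (rule distinct_card[OF cycle_of_permutation[OF Sn_permutation[OF x]]])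
  ultimately show ?thesis by simp
qed

text \<open>A permutation of cycle type \<open>T\<close> has point type \<open>spread T\<close>, and \<open>spread\<close> is injective on partitions.
  Point types are easier to handle since powers act on them pointwise.\<close>

definition point_type :: "nat \<Rightarrow> (nat \<Rightarrow> nat) \<Rightarrow> nat multiset" where
  "point_type n x = image_mset (least_power x) (mset_set {1..n})"

definition spread :: "nat multiset \<Rightarrow> nat multiset" where
  "spread T = sum_mset (image_mset (\<lambda>m. replicate_mset m m) T)"

lemma spread_simps [simp]:
  "spread {#} = {#}" "spread (add_mset m T) = replicate_mset m m + spread T"
  "spread (T + U) = spread T + spread U"
  by (simp_all add: spread_def)

lemma count_spread: "count (spread T) m = m * count T m"
  by (induction T) (auto simp: algebra_simps)

lemma spread_replicate [simp]:
  "spread (replicate_mset k m) = replicate_mset (k * m) m"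
  by (rule multiset_eqI) (simp add: count_spread)

lemma size_spread [simp]: "size (spread T) = sum_mset T"
  by (induction T) auto

text \<open>Positivity matters because a part 0 leaves no trace in the spread; for
  \<open>m > 0\<close> the multiplicity is recovered by cancelling \<open>m\<close> in
  \<open>count_spread\<close>.\<close>

lemma spread_inj:
  assumes "spread T = spread U" "0 \<notin># T" "0 \<notin># U"
  shows "T = U"
proof (rule multiset_eqI)
  fix m
  have "m * count T m = m * count U m" using assms(1) count_spread by metis
  then show "count T m = count U m"
    using assms(2,3) by (cases "m = 0") (auto simp: not_in_iff)
qed

lemma set_spread: "0 \<notin># T \<Longrightarrow> set_mset (spread T) = set_mset T"
  by (induction T) auto

lemma count_image_mset_set:
  assumes "finite A"
  shows "count (image_mset f (mset_set A)) m = card {i \<in> A. f i = m}"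
proof -
  have "count (image_mset f (mset_set A)) m = (\<Sum>i | i \<in> A \<and> m = f i. count (mset_set A) i)"
    using assms by (simp add: count_image_mset')
  also have "\<dots> = (\<Sum>i | i \<in> A \<and> m = f i. 1)"
    using assms by (intro sum.cong) auto
  also have "\<dots> = card {i \<in> A. f i = m}" by (simp add: eq_commute)
  finally show ?thesis .
qed

lemma count_point_type: "count (point_type n x) m = card {i \<in> {1..n}. least_power x i = m}"
  unfolding point_type_def by (rule count_image_mset_set) simp

lemma orbit_least_power:
  assumes "x \<in> Sn n"
  shows "least_power x ((x ^^ k) i) = least_power x i"
proof -
  have "least_power x ((x ^^ k) i) dvd j \<longleftrightarrow> least_power x i dvd j" for j
  proof -
    have "(x ^^ j) ((x ^^ k) i) = (x ^^ k) ((x ^^ j) i)"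
      by (metis add.commute comp_apply funpow_add)
    then show ?thesis
      using Sn_inj[OF Sn_funpow[OF assms], of k]
      by (auto simp: least_power_dvd_iff[OF assms] inj_eq)
  qed
  then show ?thesis by (meson dvd_antisym dvd_refl)
qed

lemma funpow_in_interval: "x \<in> Sn n \<Longrightarrow> i \<in> {1..n} \<Longrightarrow> (x ^^ k) i \<in> {1..n}"
  by (metis Sn_funpow Sn_def mem_Collect_eq permutes_in_image)

lemma orbit_eq:
  assumes "x \<in> Sn n" "j \<in> {(x ^^ k) i | k. True}"
  shows "{(x ^^ k) j | k. True} = {(x ^^ k) i | k. True}"
proof -
  note S = support_set[OF Sn_permutation[OF assms(1)]]
  have O: "{(x ^^ k) a | k. True} = set (support x a)" for a unfolding S by auto
  have "j \<in> set (support x i)" "i \<in> set (support x i)"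
    using assms(2) O unfolding S by (auto intro: range_eqI[of _ _ 0])
  then have "set (support x j) \<inter> set (support x i) \<noteq> {}"
    unfolding disjoint_support'[OF Sn_permutation[OF assms(1)]] by simp
  then show ?thesis unfolding O
    using disjoint_support[OF Sn_permutation[OF assms(1)]] unfolding disjoint_def by blast
qed

text \<open>The points on cycles of length \<open>m\<close> are the disjoint union of the orbits of
  size \<open>m\<close>.\<close>

lemma count_cycle_type:
  assumes x: "x \<in> Sn n"
  shows "m * count (cycle_type n x) m = count (point_type n x) m"
proof -
  let ?O = "\<lambda>i. {(x ^^ k) i | k. True}"
  let ?A = "{C \<in> orbits n x. card C = m}"
  have fin: "finite (orbits n x)" by (simp add: orbits_def)
  have *: "i \<in> ?O i" for i by (auto intro: exI[of _ 0])
  have union: "\<Union>?A = {i \<in> {1..n}. least_power x i = m}"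
  proof (intro equalityI subsetI)
    fix j assume "j \<in> \<Union>?A"
    then obtain i where "i \<in> {1..n}" "j \<in> ?O i" "card (?O i) = m"
      unfolding orbits_def by blast
    then show "j \<in> {i \<in> {1..n}. least_power x i = m}"
      using card_orbit[OF x] orbit_least_power[OF x] funpow_in_interval[OF x] by auto
  next
    fix j assume "j \<in> {i \<in> {1..n}. least_power x i = m}"
    then have "?O j \<in> ?A" using card_orbit[OF x] by (auto simp: orbits_def)
    then show "j \<in> \<Union>?A" using * by blast
  qed
  have "m * card ?A = card (\<Union>?A)"
  proof (rule card_partition)
    show "finite ?A" using fin by simp
    show "finite (\<Union>?A)" unfolding union by simp
    fix C D assume "C \<in> ?A" "D \<in> ?A" "C \<noteq> D"
    then show "C \<inter> D = {}" using orbit_eq[OF x] unfolding orbits_def by blast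
  qed auto
  moreover have "count (cycle_type n x) m = card ?A"
    unfolding cycle_type_def by (rule count_image_mset_set[OF fin])
  ultimately show ?thesis by (simp add: union count_point_type)
qed

lemma cycle_type_pos:
  assumes x: "x \<in> Sn n"
  shows "0 \<notin># cycle_type n x"
proof
  assume "0 \<in># cycle_type n x"
  moreover have "finite (orbits n x)" by (simp add: orbits_def)
  ultimately obtain C where "C \<in> orbits n x" "card C = 0"
    unfolding cycle_type_def by auto
  then obtain i where "least_power x i = 0"
    using card_orbit[OF x] unfolding orbits_def by auto
  then show False using least_power_permutes_pos[OF x, of i] by simp
qed

lemma spread_cycle_type:
  assumes x: "x \<in> Sn n"
  shows "spread (cycle_type n x) = point_type n x"
  by (rule multiset_eqI) (simp add: count_spread count_cycle_type[OF x])

lemma cycle_typeI: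
  assumes "x \<in> Sn n" "0 \<notin># T" "spread T = point_type n x"
  shows "cycle_type n x = T"
  using assms spread_inj[of "cycle_type n x" T] cycle_type_pos spread_cycle_type by metis

lemma sum_cycle_type: "x \<in> Sn n \<Longrightarrow> sum_mset (cycle_type n x) = n"
  using size_spread[of "cycle_type n x"] by (simp add: spread_cycle_type point_type_def)

lemma set_cycle_type: "x \<in> Sn n \<Longrightarrow> set_mset (cycle_type n x) = least_power x ` {1..n}"
  using set_spread[OF cycle_type_pos] by (simp add: spread_cycle_type point_type_def)

text \<open>This is the fact that the order is the lcm of the cycle lengths, put in terms of
  divisibility so that no lcm has to be handled.\<close>

lemma funpow_eq_id_iff_cycle_type:
  assumes x: "x \<in> Sn n"
  shows "x ^^ k = id \<longleftrightarrow> (\<forall>m\<in>#cycle_type n x. m dvd k)"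
proof -
  have "x ^^ k = id \<longleftrightarrow> (\<forall>i\<in>{1..n}. (x ^^ k) i = i)"
    using Sn_funpow[OF x, of k] by (auto simp: fun_eq_iff Sn_def permutes_def)
  then show ?thesis by (simp add: set_cycle_type[OF x] least_power_dvd_iff[OF x])
qed

lemma cycle_type_eq_perm_ord:
  assumes "x \<in> Sn n" "y \<in> Sn n" "cycle_type n x = cycle_type n y"
  shows "perm_ord x = perm_ord y"
proof -
  have "x ^^ k = id \<longleftrightarrow> y ^^ k = id" for k
    using assms funpow_eq_id_iff_cycle_type by metis
  then show ?thesis by (simp add: perm_ord_def)
qed

lemma least_power_funpow:
  assumes x: "x \<in> Sn n"
  shows "least_power (x ^^ a) i = least_power x i div gcd a (least_power x i)"
proof -
  let ?m = "least_power x i"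
  have "least_power (x ^^ a) i dvd j \<longleftrightarrow> ?m div gcd a ?m dvd j" for j
  proof -
    have "least_power (x ^^ a) i dvd j \<longleftrightarrow> ?m dvd a * j"
      by (simp add: least_power_dvd_iff[OF x] least_power_dvd_iff[OF Sn_funpow[OF x]] funpow_mult)
    also have "\<dots> \<longleftrightarrow> ?m div gcd a ?m dvd j"
    proof -
      let ?g = "gcd a ?m"
      have g: "?g > 0" using least_power_permutes_pos[OF x] by simp
      have "?m dvd a * j \<longleftrightarrow> (?m div ?g) * ?g dvd ((a div ?g) * j) * ?g"
        by (simp add: mult.commute mult.left_commute dvd_mult_div_cancel)
      also have "\<dots> \<longleftrightarrow> ?m div ?g dvd (a div ?g) * j"
        using g by (intro dvd_times_right_cancel_iff) simp
      also have "\<dots> \<longleftrightarrow> ?m div ?g dvd j"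
      proof -
        have "coprime (a div ?g) (?m div ?g)" using g by (intro div_gcd_coprime) auto
        then show ?thesis by (simp add: coprime_commute coprime_dvd_mult_right_iff)
      qed
      finally show ?thesis .
    qed
    finally show ?thesis .
  qed
  then show ?thesis by (meson dvd_antisym dvd_refl)
qed

text \<open>The power \<open>a\<close> breaks an \<open>m\<close>-cycle into \<open>gcd a m\<close>
  cycles of length \<open>m div gcd a m\<close>. These cover the same \<open>m\<close> points, so on
  point types the operation is a plain map.\<close>

lemma spread_ppower: "spread (ppower T a) = image_mset (\<lambda>m. m div gcd a m) (spread T)"
proof (induction T)
  case (add m T)
  have "gcd a m * (m div gcd a m) = m" by simp
  then show ?case using add by (simp add: ppower_def)
qed (simp add: ppower_def)

lemma ppower_pos: "0 \<notin># T \<Longrightarrow> 0 \<notin># ppower T a"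
proof (induction T)
  case (add m T)
  have "m \<noteq> 0" using add.prems by auto
  then have "\<not> m < gcd a m" using gcd_le2_nat[of m a] by linarith
  then have "m div gcd a m \<noteq> 0 \<or> gcd a m = 0" by (auto simp: div_eq_0_iff)
  then show ?case using add by (auto simp: ppower_def)
qed (simp add: ppower_def)

lemma cycle_type_funpow:
  assumes x: "x \<in> Sn n"
  shows "cycle_type n (x ^^ a) = ppower (cycle_type n x) a"
proof (rule cycle_typeI[OF Sn_funpow[OF x] ppower_pos[OF cycle_type_pos[OF x]]])
  show "spread (ppower (cycle_type n x) a) = point_type n (x ^^ a)"
    unfolding spread_ppower spread_cycle_type[OF x] unfolding point_type_def multiset.map_comp
    by (rule image_mset_cong) (simp only: least_power_funpow[OF x] comp_apply)
qed

section \<open>Cycles given by lists, and a permutation for every partition\<close>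

lemma funpow_cycle_of_list:
  assumes "distinct xs" "i < length xs"
  shows "(cycle_of_list xs ^^ k) (xs ! i) = xs ! ((i + k) mod length xs)"
proof -
  have "(cycle_of_list xs ^^ k) (xs ! i) = map (cycle_of_list xs ^^ k) xs ! i" using assms by simp
  also have "\<dots> = rotate k xs ! i" by (simp add: cyclic_rotation[OF assms(1)])
  finally show ?thesis using assms(2) by (simp add: nth_rotate add.commute)
qed

lemma least_power_cycle_of_list:
  assumes "distinct xs" "a \<in> set xs"
  shows "least_power (cycle_of_list xs) a = length xs"
proof -
  obtain i where i: "i < length xs" "a = xs ! i" using assms(2) by (metis in_set_conv_nth)
  have "least_power (cycle_of_list xs) a dvd k \<longleftrightarrow> length xs dvd k" for k
  proof -
    have "(cycle_of_list xs ^^ k) a = a \<longleftrightarrow> (i + k) mod length xs = i"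
      using i assms(1) by (subst i(2), subst funpow_cycle_of_list[OF assms(1) i(1)])
        (simp add: nth_eq_iff_index_eq mod_less_divisor[OF order.strict_trans1[OF _ i(1)]])
    also have "\<dots> \<longleftrightarrow> [i + k = i + 0] (mod length xs)" using i(1) by (simp add: cong_def)
    also have "\<dots> \<longleftrightarrow> length xs dvd k" by (subst cong_add_lcancel_nat) (simp add: cong_0_iff)
    finally show ?thesis by (simp add: least_power_dvd[OF permutation_of_cycle])
  qed
  then show ?thesis by (meson dvd_antisym dvd_refl)
qed

lemma cycle_of_list_Sn: "set xs \<subseteq> {1..n} \<Longrightarrow> cycle_of_list xs \<in> Sn n"
  unfolding Sn_def by (auto intro: permutes_subset[OF cycle_permutes])

lemma Sn_mono: "m \<le> n \<Longrightarrow> Sn m \<subseteq> Sn n"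
  unfolding Sn_def by (auto intro: permutes_subset)

lemma least_power_cong:
  assumes "\<And>k. (f ^^ k) i = (g ^^ k) i"
  shows "least_power f i = least_power g i"
  by (simp add: least_power_def assms)

text \<open>The induction puts the new \<open>m\<close>-cycle on the fresh points
  \<open>n + 1, ..., n + m\<close>. On each of the two invariant blocks the powers of the product
  agree with those of one factor, so the least powers are inherited.\<close>

lemma ex_cycle_type:
  assumes "0 \<notin># T"
  shows "\<exists>x\<in>Sn (sum_mset T). cycle_type (sum_mset T) x = T"
  using assms
proof (induction T)
  case empty
  have "id \<in> Sn 0" by (simp add: Sn_def)
  then show ?case by (auto simp: cycle_type_def orbits_def)
next
  case (add m T)
  define n where "n = sum_mset T"
  define xs where "xs = [Suc n..<Suc (n + m)]"
  obtain x where x: "x \<in> Sn n" "cycle_type n x = T"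
    using add by (auto simp: n_def)
  let ?c = "cycle_of_list xs"
  let ?y = "x \<circ> ?c"
  have set_xs: "set xs = {Suc n..n + m}" by (auto simp: xs_def)
  have "?c \<in> Sn (n + m)" by (rule cycle_of_list_Sn) (auto simp: set_xs)
  then have y: "?y \<in> Sn (n + m)" using x(1) Sn_mono[of n "n + m"] by (intro Sn_comp) auto
  have c_low: "?c j = j" if "j \<in> {1..n}" for j using that by (intro id_outside_supp) (auto simp: set_xs)
  have x_high: "x j = j" if "j > n" for j using x(1) that by (simp add: Sn_def permutes_def)
  have "(?y ^^ k) j = (x ^^ k) j" if "j \<in> {1..n}" for j k
  proof (induction k)
    case (Suc k)
    then show ?case using funpow_in_interval[OF x(1) that, of k] c_low by simp
  qed simp
  then have low: "least_power ?y j = least_power x j" if "j \<in> {1..n}" for j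
    using that by (intro least_power_cong)
  have "(?y ^^ k) j = (?c ^^ k) j" if "j \<in> set xs" for j k
  proof (induction k)
    case (Suc k)
    have "(?c ^^ Suc k) j \<in> set xs"
      using that by (rule permutes_in_image[OF permutes_funpow[OF cycle_permutes], THEN iffD2])
    then have "x ((?c ^^ Suc k) j) = (?c ^^ Suc k) j" by (intro x_high) (auto simp: set_xs)
    then show ?case using Suc by simp
  qed simp
  then have "least_power ?y j = least_power ?c j" if "j \<in> set xs" for j
    using that by (intro least_power_cong)
  then have high: "least_power ?y j = m" if "j \<in> set xs" for j
    using that least_power_cycle_of_list[of xs j] by (simp add: xs_def)
  have "{1..n + m} = {1..n} \<union> set xs" "{1..n} \<inter> set xs = {}" by (auto simp: set_xs)
  then have "mset_set {1..n + m} = mset_set {1..n} + mset_set (set xs)"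
    by (simp add: mset_set_Union)
  then have "point_type (n + m) ?y =
      image_mset (least_power ?y) (mset_set {1..n}) + image_mset (least_power ?y) (mset_set (set xs))"
    by (simp add: point_type_def)
  also have "image_mset (least_power ?y) (mset_set {1..n}) = point_type n x"
    unfolding point_type_def using low by (intro image_mset_cong) simp
  also have "image_mset (least_power ?y) (mset_set (set xs)) = image_mset (\<lambda>_. m) (mset_set (set xs))"
    using high by (intro image_mset_cong) simp
  also have "\<dots> = replicate_mset m m"
    by (simp add: image_mset_const_eq set_xs)
  also have "point_type n x = spread T" using x spread_cycle_type by metis
  finally have "spread (add_mset m T) = point_type (n + m) ?y"
    by (simp only: spread_simps add.commute)
  then have "cycle_type (n + m) ?y = add_mset m T"
    by (rule cycle_typeI[OF y add.prems])
  then show ?case using y by (auto simp: n_def add.commute[of m])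
qed

lemma cycle_type_image: "cycle_type n ` Sn n = partitions n"
proof (intro equalityI subsetI)
  fix T assume "T \<in> cycle_type n ` Sn n"
  then show "T \<in> partitions n"
    using sum_cycle_type cycle_type_pos by (fastforce simp: partitions_def intro: gr0I)
next
  fix T assume "T \<in> partitions n"
  then have "0 \<notin># T" "sum_mset T = n" by (auto simp: partitions_def)
  then show "T \<in> cycle_type n ` Sn n" using ex_cycle_type[of T] by (metis image_eqI)
qed

lemma all_ones_iff: "(\<forall>m\<in>#T. m = 1) \<longleftrightarrow> T = replicate_mset (sum_mset T) (1 :: nat)"
proof
  show "\<forall>m\<in>#T. m = 1 \<Longrightarrow> T = replicate_mset (sum_mset T) 1"
    by (induction T) auto
  show "\<forall>m\<in>#T. m = 1" if "T = replicate_mset (sum_mset T) 1"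
    using that by (metis in_replicate_mset)
qed

lemma cycle_type_eq_trivial_iff:
  assumes x: "x \<in> Sn n"
  shows "cycle_type n x = replicate_mset n 1 \<longleftrightarrow> x = id"
  using all_ones_iff[of "cycle_type n x"] funpow_eq_id_iff_cycle_type[OF x, of 1]
  by (simp add: sum_cycle_type[OF x])

lemma TV_eq: "TV n = cycle_type n ` PV n"
proof -
  have "TV n = cycle_type n ` Sn n - {replicate_mset n 1}" by (simp add: TV_def cycle_type_image)
  also have "\<dots> = cycle_type n ` PV n"
  proof (intro equalityI subsetI)
    fix T assume "T \<in> cycle_type n ` Sn n - {replicate_mset n 1}"
    then obtain x where "x \<in> Sn n" "T = cycle_type n x" "T \<noteq> replicate_mset n 1" by blast
    then show "T \<in> cycle_type n ` PV n"
      using cycle_type_eq_trivial_iff[of x n] by (auto simp: PV_def)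
  next
    fix T assume "T \<in> cycle_type n ` PV n"
    then obtain x where "x \<in> Sn n" "T = cycle_type n x" "x \<noteq> id" by (auto simp: PV_def)
    then show "T \<in> cycle_type n ` Sn n - {replicate_mset n 1}"
      using cycle_type_eq_trivial_iff[of x n] by auto
  qed
  finally show ?thesis .
qed

section \<open>Connectivity of the power graph away from the \<open>p\<close>-cycles\<close>

definition linked :: "nat \<Rightarrow> (nat \<Rightarrow> nat) \<Rightarrow> (nat \<Rightarrow> nat) \<Rightarrow> bool" where
  "linked n = (adj (PV n) PE)\<^sup>*\<^sup>*"

lemma PV_iff: "x \<in> PV n \<longleftrightarrow> x \<in> Sn n \<and> x \<noteq> id"
  by (auto simp: PV_def)

lemma PE_funpow: "k \<ge> 1 \<Longrightarrow> PE x (x ^^ k)"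
  by (auto simp: PE_def ppow_def)

lemma PE_sym: "PE x y \<Longrightarrow> PE y x"
  by (auto simp: PE_def)

lemma linked_PE:
  assumes "x \<in> PV n" "y \<in> PV n" "PE x y"
  shows "linked n x y"
proof (cases "x = y")
  case False
  then have "adj (PV n) PE x y" using assms by (simp add: adj_def)
  then show ?thesis unfolding linked_def by blast
qed (simp add: linked_def)

lemma linked_trans: "linked n x y \<Longrightarrow> linked n y z \<Longrightarrow> linked n x z"
  unfolding linked_def by (rule rtranclp_trans)

lemma linked_sym:
  assumes "linked n x y"
  shows "linked n y x"
  using assms unfolding linked_def
proof (induction rule: rtranclp_induct)
  case (step y z)
  then have "adj (PV n) PE z y" by (auto simp: adj_def intro: PE_sym)
  then show ?case using step(3) by (rule converse_rtranclp_into_rtranclp)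
qed simp

section \<open>Commuting permutations of coprime orders\<close>

lemma funpow_comp_commute:
  assumes "x \<circ> y = y \<circ> x"
  shows "(x \<circ> y) ^^ k = x ^^ k \<circ> y ^^ k"
proof (induction k)
  case (Suc k)
  have *: "y ((x ^^ j) a) = (x ^^ j) (y a)" for j a
  proof (induction j)
    case (Suc j)
    have "y (x b) = x (y b)" for b using assms by (metis comp_apply)
    then show ?case using Suc by simp
  qed simp
  show ?case
  proof
    fix a
    have "((x \<circ> y) ^^ Suc k) a = x (y (((x \<circ> y) ^^ k) a))" by simp
    also have "\<dots> = x (y ((x ^^ k) ((y ^^ k) a)))" by (simp only: Suc comp_apply)
    also have "\<dots> = (x ^^ Suc k \<circ> y ^^ Suc k) a" by (simp add: *)
    finally show "((x \<circ> y) ^^ Suc k) a = (x ^^ Suc k \<circ> y ^^ Suc k) a" .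
  qed
qed simp

text \<open>The Chinese remainder theorem gives \<open>k\<close> congruent to 1 modulo
  \<open>a\<close> and to 0 modulo \<open>b\<close>, so that in the power \<open>k\<close> of the
  product \<open>y\<close> disappears and \<open>x\<close> survives. The condition
  \<open>x \<noteq> id\<close> excludes \<open>k = 0\<close>, which is no exponent for an
  edge.\<close>

lemma coprime_orders_power:
  assumes comm: "x \<circ> y = y \<circ> x" and "x ^^ a = id" "y ^^ b = id" "coprime a b" "x \<noteq> id"
  obtains k where "k \<ge> 1" "x = (x \<circ> y) ^^ k"
proof -
  obtain k where k: "[k = 1] (mod a)" "[k = 0] (mod b)"
    using binary_chinese_remainder_nat[OF assms(4)] by metis
  have "x ^^ k = x"
    using funpow_mod_of_id[OF assms(2), of k] funpow_mod_of_id[OF assms(2), of 1] k(1)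
    by (simp add: cong_def)
  moreover have "y ^^ k = id"
    using funpow_mod_of_id[OF assms(3), of k] k(2) by (simp add: cong_def)
  ultimately have z: "x = (x \<circ> y) ^^ k" by (simp add: funpow_comp_commute[OF comm])
  moreover have "k \<noteq> 0" using z assms(5) by (intro notI) simp
  ultimately show ?thesis using that[of k] by simp
qed

text \<open>The path is \<open>x\<close>, \<open>x \<circ> y\<close>, \<open>y\<close>. Its middle
  vertex is not the identity because \<open>x\<close> is one of its powers.\<close>

lemma linked_commute:
  assumes x: "x \<in> PV n" and y: "y \<in> PV n" and comm: "x \<circ> y = y \<circ> x"
    and "x ^^ a = id" "y ^^ b = id" "coprime a b"
  shows "linked n x y"
proof -
  obtain k where k: "k \<ge> 1" "x = (x \<circ> y) ^^ k"
    using coprime_orders_power[OF comm assms(4-6)] x unfolding PV_iff by metis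
  have "coprime b a" using assms(6) by (rule coprime_commute[THEN iffD1])
  then obtain j where j: "j \<ge> 1" "y = (x \<circ> y) ^^ j"
    using coprime_orders_power[OF comm[symmetric] assms(5,4)] y comm unfolding PV_iff by metis
  have "x \<circ> y \<noteq> id" using k x unfolding PV_iff by (metis id_funpow)
  then have z: "x \<circ> y \<in> PV n" using x y by (simp add: PV_iff Sn_comp)
  have "PE (x \<circ> y) x" using PE_funpow[OF k(1), of "x \<circ> y"] k(2) by simp
  moreover have "PE (x \<circ> y) y" using PE_funpow[OF j(1), of "x \<circ> y"] j(2) by simp
  ultimately show ?thesis
    using linked_PE[OF x z PE_sym] linked_PE[OF z y] linked_trans by metis
qed

lemma ex_distinct_list:
  assumes "finite A" "k \<le> card A"
  obtains xs where "distinct xs" "length xs = k" "set xs \<subseteq> A"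
proof -
  obtain B where B: "B \<subseteq> A" "card B = k" "finite B"
    using obtain_subset_with_card_n[OF assms(2)] by metis
  obtain xs where "set xs = B" "distinct xs" using finite_distinct_list[OF B(3)] by blast
  then show ?thesis using that B distinct_card[of xs] by simp
qed

lemma ex_points_outside:
  assumes "finite S" "card S + k \<le> n"
  obtains xs where "distinct xs" "length xs = k" "set xs \<subseteq> {1..n}" "set xs \<inter> S = {}"
proof -
  have "card {1..n} - card S \<le> card ({1..n} - S)" by (rule diff_card_le_card_Diff) fact
  then have "k \<le> card ({1..n} - S)" using assms(2) by simp
  then obtain xs where "distinct xs" "length xs = k" "set xs \<subseteq> {1..n} - S"
    using ex_distinct_list[of "{1..n} - S" k] by auto
  then show ?thesis using that[of xs] by auto
qed

lemma cycle_of_list_funpow_length: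
  assumes "distinct xs"
  shows "cycle_of_list xs ^^ length xs = id"
proof
  fix a
  have fix_out: "(cycle_of_list xs ^^ k) a = a" if "a \<notin> set xs" for k
    using id_outside_supp[OF that] by (induction k) auto
  show "(cycle_of_list xs ^^ length xs) a = id a"
  proof (cases "a \<in> set xs")
    case True
    then obtain i where "i < length xs" "a = xs ! i" by (metis in_set_conv_nth)
    then show ?thesis by (simp add: funpow_cycle_of_list[OF assms])
  qed (simp add: fix_out)
qed

lemma cycle_of_list_PV:
  assumes "distinct xs" "length xs \<ge> 2" "set xs \<subseteq> {1..n}"
  shows "cycle_of_list xs \<in> PV n"
proof -
  have "(cycle_of_list xs ^^ 1) (xs ! 0) = xs ! ((0 + 1) mod length xs)"
    using assms(2) by (intro funpow_cycle_of_list[OF assms(1)]) linarith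
  moreover have "(0 + 1) mod length xs = 1" using assms(2) by simp
  ultimately have "cycle_of_list xs (xs ! 0) = xs ! 1" by simp
  moreover have "xs ! 1 \<noteq> xs ! 0" using assms(1,2) nth_eq_iff_index_eq[of xs 1 0] by linarith
  ultimately have "cycle_of_list xs \<noteq> id" by (intro notI) simp
  then show ?thesis using cycle_of_list_Sn[OF assms(3)] by (simp add: PV_iff)
qed

lemma commute_fixed_cycle:
  assumes "inj x" "\<forall>a\<in>set xs. x a = a"
  shows "x \<circ> cycle_of_list xs = cycle_of_list xs \<circ> x"
proof
  fix a
  show "(x \<circ> cycle_of_list xs) a = (cycle_of_list xs \<circ> x) a"
  proof (cases "a \<in> set xs")
    case True
    then have "cycle_of_list xs a \<in> set xs" by (simp add: permutes_in_image[OF cycle_permutes])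
    then show ?thesis using True assms(2) by simp
  next
    case False
    have "x a \<notin> set xs"
    proof
      assume "x a \<in> set xs"
      moreover from this have "x a = a" using assms by (auto dest: injD)
      ultimately show False using False by simp
    qed
    then show ?thesis using False by (simp add: id_outside_supp)
  qed
qed

lemma linked_fixed_cycle:
  assumes x: "x \<in> PV n" "x ^^ q = id" and xs: "distinct xs" "length xs \<ge> 2" "set xs \<subseteq> {1..n}"
    and "coprime q (length xs)" "\<forall>a\<in>set xs. x a = a"
  shows "linked n x (cycle_of_list xs)"
proof (rule linked_commute[OF x(1) cycle_of_list_PV[OF xs] _ x(2) cycle_of_list_funpow_length[OF xs(1)] assms(6)])
  have "inj x" using x(1) by (auto simp: PV_iff intro: Sn_inj)
  then show "x \<circ> cycle_of_list xs = cycle_of_list xs \<circ> x"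
    using assms(7) by (rule commute_fixed_cycle)
qed

text \<open>The link is a 3-cycle disjoint from both, on three of the points that the two
  transpositions leave fixed.\<close>

lemma linked_transpositions:
  assumes n: "n \<ge> 7" and ab: "distinct ab" "length ab = 2" "set ab \<subseteq> {1..n}"
    and cd: "distinct cd" "length cd = 2" "set cd \<subseteq> {1..n}"
  shows "linked n (cycle_of_list ab) (cycle_of_list cd)"
proof -
  have "card (set ab \<union> set cd) \<le> 4"
    using card_Un_le[of "set ab" "set cd"] ab cd by (simp add: distinct_card)
  then obtain xs where xs: "distinct xs" "length xs = 3" "set xs \<subseteq> {1..n}"
    "set xs \<inter> (set ab \<union> set cd) = {}"
    using ex_points_outside[of "set ab \<union> set cd" 3 n] n by auto
  have "linked n (cycle_of_list es) (cycle_of_list xs)"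
    if es: "distinct es" "length es = 2" "set es \<subseteq> {1..n}" "set xs \<inter> set es = {}" for es
  proof (rule linked_fixed_cycle)
    show "cycle_of_list es \<in> PV n" using es by (intro cycle_of_list_PV) auto
    show "cycle_of_list es ^^ 2 = id" using cycle_of_list_funpow_length[OF es(1)] es(2) by simp
    show "coprime 2 (length xs)" by (simp add: xs)
    show "\<forall>a\<in>set xs. cycle_of_list es a = a" using es(4) by (auto intro!: id_outside_supp)
  qed (use xs in auto)
  from this[OF ab] this[OF cd] xs(4) show ?thesis
    by (auto intro: linked_trans linked_sym)
qed

section \<open>Paths to the transposition (1 2)\<close>

definition base :: "nat \<Rightarrow> nat" where
  "base = Transposition.transpose 1 2"

lemma base_eq: "base = cycle_of_list [1, 2]"
  by (simp add: base_def)

lemma linked_base_odd: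
  assumes n: "n \<ge> 8" and x: "x \<in> PV n" "x ^^ q = id" "odd q"
    and ab: "a \<noteq> b" "{a, b} \<subseteq> {1..n}" "x a = a" "x b = b"
  shows "linked n x base"
proof -
  have "coprime q (length [a, b])" using x(3) by (simp flip: numeral_2_eq_2)
  then have "linked n x (cycle_of_list [a, b])"
    using ab by (intro linked_fixed_cycle[OF x(1,2)]) auto
  moreover have "linked n (cycle_of_list [a, b]) base"
    unfolding base_eq by (rule linked_transpositions) (use n ab in auto)
  ultimately show ?thesis by (rule linked_trans)
qed

text \<open>Enough fixed points remain for a 3-cycle, which has odd order and fixes two points
  itself, so \<open>linked_base_odd\<close> applies to it. The set \<open>S\<close> only has to
  contain the moved points, so a caller may list points without checking that they differ.\<close>

lemma linked_base_involution_small: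
  assumes n: "n \<ge> 8" and x: "x \<in> PV n" "x ^^ 2 = id"
    and S: "finite S" "card S \<le> 4" "\<And>a. x a \<noteq> a \<Longrightarrow> a \<in> S"
  shows "linked n x base"
proof -
  obtain xs where xs: "distinct xs" "length xs = 3" "set xs \<subseteq> {1..n}" "set xs \<inter> S = {}"
    using ex_points_outside[OF S(1), of 3 n] S(2) n by auto
  have "linked n x (cycle_of_list xs)"
    using xs S(3) by (intro linked_fixed_cycle[OF x]) auto
  moreover have "linked n (cycle_of_list xs) base"
  proof -
    obtain ys where ys: "distinct ys" "length ys = 2" "set ys \<subseteq> {1..n}" "set ys \<inter> set xs = {}"
      using ex_points_outside[of "set xs" 2 n] n xs by (auto simp: distinct_card)
    then obtain a b where "ys = [a, b]"
      by (metis (no_types, opaque_lifting) Suc_1 length_0_conv length_Suc_conv One_nat_def)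
    then show ?thesis
      using cycle_of_list_funpow_length[OF xs(1)] xs ys n
      by (intro linked_base_odd[of n _ 3 a b] cycle_of_list_PV id_outside_supp) auto
  qed
  ultimately show ?thesis by (rule linked_trans)
qed

text \<open>An involution with three 2-cycles \<open>(a x(a))\<close>, \<open>(c x(c))\<close>, \<open>(e x(e))\<close> commutes with
  \<open>(a c e)(x(a) x(c) x(e))\<close>, which has order 3 and at least two fixed points.\<close>

lemma linked_base_involution_large:
  assumes n: "n \<ge> 8" and x: "x \<in> PV n" "x ^^ 2 = id"
    and moved: "x a \<noteq> a" "x c \<noteq> c" "x e \<noteq> e"
    and c: "c \<notin> {a, x a}" and e: "e \<notin> {a, x a, c, x c}"
  shows "linked n x base"
proof -
  have xx: "x (x i) = i" for i using x(2) by (simp add: fun_eq_iff numeral_2_eq_2)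
  have xS: "x \<in> Sn n" and xperm: "x permutes {1..n}" using x(1) by (auto simp: PV_iff Sn_def)
  define xs where "xs = [a, c, e]"
  define ys where "ys = map x xs"
  have dist: "distinct xs" "distinct ys" "set xs \<inter> set ys = {}"
  proof -
    have "x c \<noteq> a" "x e \<noteq> a" "x e \<noteq> c" "x a \<noteq> x c" "x a \<noteq> x e" "x c \<noteq> x e"
      using c e xx by (metis insertCI)+
    then show "distinct xs" "distinct ys" "set xs \<inter> set ys = {}"
      using moved c e by (auto simp: xs_def ys_def)
  qed
  have in_n: "i \<in> {1..n}" if "x i \<noteq> i" for i using xperm that unfolding permutes_def by blast
  have sub: "set xs \<subseteq> {1..n}" "set ys \<subseteq> {1..n}"
    using in_n moved xx by (auto simp: xs_def ys_def simp del: atLeastAtMost_iff)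
  let ?c = "cycle_of_list xs" and ?d = "cycle_of_list ys"
  \<comment> \<open>As \<open>x\<close> is its own inverse, conjugation by \<open>x\<close> swaps
    \<open>?c\<close> and \<open>?d\<close>. It therefore preserves their product, since the two
    cycles commute.\<close>
  have conj: "x \<circ> ?c \<circ> x = ?d"
  proof -
    have "inv x = x" by (rule inv_unique_comp) (auto simp: fun_eq_iff xx)
    then show ?thesis unfolding ys_def
      using conjugation_of_cycle[OF dist(1) permutes_bij[OF xperm]] by simp
  qed
  have cd: "?c \<circ> ?d = ?d \<circ> ?c" by (rule cycles_commute) (use dist in auto)
  have comm: "x \<circ> (?c \<circ> ?d) = (?c \<circ> ?d) \<circ> x"
  proof
    fix i
    have d: "?d j = x (?c (x j))" for j using conj by (auto simp: fun_eq_iff)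
    have "x (?c (?d i)) = ?d (?c (x i))" using d xx by simp
    also have "\<dots> = ?c (?d (x i))" using cd by (auto simp: fun_eq_iff)
    finally show "(x \<circ> (?c \<circ> ?d)) i = ((?c \<circ> ?d) \<circ> x) i" by simp
  qed
  have 3: "(?c \<circ> ?d) ^^ 3 = id"
  proof -
    have "length xs = 3" "length ys = 3" by (simp_all add: xs_def ys_def)
    then have "?c ^^ 3 = id" "?d ^^ 3 = id"
      using cycle_of_list_funpow_length[OF dist(1)] cycle_of_list_funpow_length[OF dist(2)] by metis+
    then show ?thesis unfolding funpow_comp_commute[OF cd] by simp
  qed
  have fixed: "(?c \<circ> ?d) i = i" if "i \<notin> set xs \<union> set ys" for i
    using that by (simp add: id_outside_supp)
  \<comment> \<open>The product moves \<open>a\<close> to \<open>c\<close>, hence is not the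
    identity and is a vertex.\<close>
  have "?d a = a" using dist(3) by (intro id_outside_supp) (auto simp: xs_def)
  moreover have "?c a = c" using c e by (simp add: xs_def transpose_def)
  ultimately have "(?c \<circ> ?d) a \<noteq> a" using c by simp
  then have PV: "?c \<circ> ?d \<in> PV n"
    using Sn_comp[OF cycle_of_list_Sn[OF sub(1)] cycle_of_list_Sn[OF sub(2)]]
    unfolding PV_iff by (metis id_apply)
  have "linked n x (?c \<circ> ?d)" by (rule linked_commute[OF x(1) PV comm x(2) 3]) simp
  moreover have "linked n (?c \<circ> ?d) base"
  proof -
    have "card (set xs \<union> set ys) \<le> 6"
      using card_Un_le[of "set xs" "set ys"] dist by (simp add: distinct_card xs_def ys_def)
    then obtain zs where zs: "distinct zs" "length zs = 2" "set zs \<subseteq> {1..n}"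
      "set zs \<inter> (set xs \<union> set ys) = {}"
      using ex_points_outside[of "set xs \<union> set ys" 2 n] n by auto
    obtain u v where uv: "zs = [u, v]"
      using zs(2) by (metis (no_types, opaque_lifting) Suc_1 length_0_conv length_Suc_conv One_nat_def)
    show ?thesis
      by (rule linked_base_odd[OF n PV 3, of u v]) (use zs uv fixed in auto)
  qed
  ultimately show ?thesis by (rule linked_trans)
qed

text \<open>The moved points form 2-cycles: one or two of these give at most four moved points, and
  from three on there are representatives \<open>a\<close>, \<open>c\<close>,
  \<open>e\<close>.\<close>

lemma linked_base_involution:
  assumes n: "n \<ge> 8" and x: "x \<in> PV n" "x ^^ 2 = id"
  shows "linked n x base"
proof -
  obtain a where a: "x a \<noteq> a" using x(1) by (auto simp: PV_iff fun_eq_iff)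
  show ?thesis
  proof (cases "\<exists>c. x c \<noteq> c \<and> c \<notin> {a, x a}")
    case True
    then obtain c where c: "x c \<noteq> c" "c \<notin> {a, x a}" by metis
    show ?thesis
    proof (cases "\<exists>e. x e \<noteq> e \<and> e \<notin> {a, x a, c, x c}")
      case True
      then obtain e where "x e \<noteq> e" "e \<notin> {a, x a, c, x c}" by metis
      then show ?thesis using linked_base_involution_large[OF n x a c(1) _ c(2)] by metis
    next
      case False
      have "card {a, x a, c, x c} \<le> 4" by (simp add: card_insert_if)
      then show ?thesis using False
        by (intro linked_base_involution_small[OF n x, of "{a, x a, c, x c}"]) auto
    qed
  next
    case False
    have "card {a, x a} \<le> 4" by (simp add: card_insert_if)
    then show ?thesis using False
      by (intro linked_base_involution_small[OF n x, of "{a, x a}"]) auto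
  qed
qed

lemma funpow_eq_iff_cong:
  assumes "x \<in> Sn n"
  shows "(x ^^ i) a = (x ^^ j) a \<longleftrightarrow> [i = j] (mod least_power x a)"
proof -
  have *: "(x ^^ i) a = (x ^^ j) a \<longleftrightarrow> [i = j] (mod least_power x a)" if "i \<le> j" for i j
  proof -
    have "(x ^^ j) a = (x ^^ i) ((x ^^ (j - i)) a)"
      using that by (metis comp_apply funpow_add le_add_diff_inverse)
    then have "(x ^^ i) a = (x ^^ j) a \<longleftrightarrow> (x ^^ (j - i)) a = a"
      using Sn_inj[OF Sn_funpow[OF assms], of i] by (metis inj_eq)
    also have "\<dots> \<longleftrightarrow> least_power x a dvd j - i" by (rule least_power_dvd_iff[OF assms, symmetric])
    also have "\<dots> \<longleftrightarrow> [j = i] (mod least_power x a)" using that by (simp add: cong_altdef_nat)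
    finally show ?thesis by (simp only: cong_sym_eq)
  qed
  show ?thesis
  proof (cases "i \<le> j")
    case False
    then show ?thesis using *[of j i] by (metis cong_sym_eq nat_le_linear)
  qed (rule *)
qed

text \<open>Two orbits of the same length are swapped by an involution commuting with \<open>x\<close>.\<close>

lemma linked_involution_two_orbits:
  assumes x: "x \<in> PV n" "x ^^ q = id" "odd q"
    and a: "a \<in> {1..n}" and b: "b \<in> {1..n}" and lp: "least_power x a = least_power x b"
    and ab: "\<And>i. b \<noteq> (x ^^ i) a"
  obtains t where "t \<in> PV n" "t ^^ 2 = id" "linked n x t"
proof -
  have xS: "x \<in> Sn n" using x by (simp add: PV_iff)
  define A where "A = range (\<lambda>i. (x ^^ i) a)"
  define B where "B = range (\<lambda>i. (x ^^ i) b)"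
  \<comment> \<open>Equal cycle lengths make the assignment of \<open>(x ^^ i) b\<close> to
    \<open>(x ^^ i) a\<close> well defined, in both directions.\<close>
  have wd: "(x ^^ i) a = (x ^^ j) a \<longleftrightarrow> (x ^^ i) b = (x ^^ j) b" for i j
    by (simp add: funpow_eq_iff_cong[OF xS] lp)
  have disj: "(x ^^ i) a \<noteq> (x ^^ j) b" for i j
  proof
    assume eq: "(x ^^ i) a = (x ^^ j) b"
    \<comment> \<open>As \<open>x ^^ q = id\<close>, the exponent \<open>q * j - j\<close> stands
      for \<open>- j\<close>: it undoes \<open>x ^^ j\<close> and would put \<open>b\<close> on the
      orbit of \<open>a\<close>.\<close>
    have "b = (x ^^ (q * j)) b" using x(2) by (simp flip: funpow_mult)
    also have "\<dots> = (x ^^ ((q * j - j) + j)) b"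
      using x(3) by (cases q) (simp_all add: add.commute)
    also have "\<dots> = (x ^^ (q * j - j)) ((x ^^ i) a)" by (simp only: funpow_add comp_apply eq)
    also have "\<dots> = (x ^^ (q * j - j + i)) a" by (simp only: funpow_add comp_apply)
    finally show False using ab by blast
  qed
  \<comment> \<open>\<open>SOME\<close> picks one exponent for each point; by \<open>wd\<close> the
    value does not depend on the choice.\<close>
  define t where "t y = (if y \<in> A then (x ^^ (SOME i. y = (x ^^ i) a)) b
    else if y \<in> B then (x ^^ (SOME i. y = (x ^^ i) b)) a else y)" for y
  have tA: "t ((x ^^ i) a) = (x ^^ i) b" for i
  proof -
    have "(x ^^ i) a \<in> A" by (auto simp: A_def)
    moreover have "(x ^^ i) a = (x ^^ (SOME j. (x ^^ i) a = (x ^^ j) a)) a" by (rule someI) (rule refl)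
    ultimately show ?thesis by (simp add: t_def flip: wd)
  qed
  have tB: "t ((x ^^ i) b) = (x ^^ i) a" for i
  proof -
    have "(x ^^ i) b \<in> B" "(x ^^ i) b \<notin> A" using disj by (auto simp: A_def B_def) metis
    moreover have "(x ^^ i) b = (x ^^ (SOME j. (x ^^ i) b = (x ^^ j) b)) b" by (rule someI) (rule refl)
    ultimately show ?thesis by (simp add: t_def wd)
  qed
  have tO: "t y = y" if "y \<notin> A" "y \<notin> B" for y using that by (simp add: t_def)
  have orbit_cases: "thesis'" if "\<And>i. y = (x ^^ i) a \<Longrightarrow> thesis'" "\<And>i. y = (x ^^ i) b \<Longrightarrow> thesis'"
    "y \<notin> A \<Longrightarrow> y \<notin> B \<Longrightarrow> thesis'" for y thesis'
    using that unfolding A_def B_def by blast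
  have tt: "t (t y) = y" for y by (rule orbit_cases[of y]) (simp_all add: tA tB tO)
  \<comment> \<open>The inverse of \<open>x\<close> is \<open>x ^^ (q - 1)\<close>, so the orbits
    are closed under preimages too. Hence \<open>x\<close> keeps the points off both orbits, where
    \<open>t\<close> is trivial, off them.\<close>
  have outA: "x y \<in> A \<Longrightarrow> y \<in> A" and outB: "x y \<in> B \<Longrightarrow> y \<in> B" for y
  proof -
    have preimage: "y \<in> range (\<lambda>i. (x ^^ i) u)" if xy: "x y = (x ^^ i) u" for i u
    proof -
      have "y = (x ^^ q) y" using x(2) by simp
      also have "\<dots> = (x ^^ (q - 1)) (x y)"
        using x(3) by (cases q) (simp_all add: funpow_swap1)
      also have "\<dots> = (x ^^ (q - 1 + i)) u" by (simp only: xy funpow_add comp_apply)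
      finally show ?thesis by blast
    qed
    show "x y \<in> A \<Longrightarrow> y \<in> A" "x y \<in> B \<Longrightarrow> y \<in> B"
      unfolding A_def B_def using preimage by blast+
  qed
  have comm: "x \<circ> t = t \<circ> x"
  proof
    fix y
    show "(x \<circ> t) y = (t \<circ> x) y"
    proof (rule orbit_cases[of y])
      fix i assume "y = (x ^^ i) a"
      then show ?thesis using tA[of i] tA[of "Suc i"] by simp
    next
      fix i assume "y = (x ^^ i) b"
      then show ?thesis using tB[of i] tB[of "Suc i"] by simp
    next
      assume "y \<notin> A" "y \<notin> B"
      then show ?thesis using outA outB tO by (metis comp_apply)
    qed
  qed
  have AB: "A \<subseteq> {1..n}" "B \<subseteq> {1..n}"
    unfolding A_def B_def using funpow_in_interval[OF xS a] funpow_in_interval[OF xS b] by auto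
  have "t permutes {1..n}"
    unfolding permutes_def
  proof (intro conjI allI impI)
    fix y show "y \<notin> {1..n} \<Longrightarrow> t y = y" using AB tO by blast
    show "\<exists>!z. t z = y" using tt by metis
  qed
  moreover have "t a = b" using tA[of 0] by simp
  then have "t \<noteq> id" using ab[of 0] by auto
  ultimately have "t \<in> PV n" by (simp add: PV_iff Sn_def)
  moreover have t2: "t ^^ 2 = id" by (simp add: fun_eq_iff numeral_2_eq_2 tt)
  moreover have "linked n x t"
    by (rule linked_commute[OF x(1) \<open>t \<in> PV n\<close> comm x(2) t2]) (use x(3) in simp)
  ultimately show ?thesis by (rule that)
qed

lemma least_power_prime:
  assumes "x \<in> Sn n" "x ^^ q = id" "prime q" "x a \<noteq> a"
  shows "least_power x a = q"
  using assms least_power_dvd_iff[OF assms(1), of a q] least_power_dvd_iff[OF assms(1), of a 1]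
  by (auto simp: prime_nat_iff)

text \<open>For odd \<open>q\<close> every moved point lies on a \<open>q\<close>-cycle. A second
  \<open>q\<close>-cycle yields a commuting involution; a single one leaves
  \<open>n - q \<ge> 2\<close> fixed points.\<close>

lemma linked_base_prime:
  assumes n: "n \<ge> 8" and x: "x \<in> PV n" "x ^^ q = id" and q: "prime q" "q + 2 \<le> n"
  shows "linked n x base"
proof (cases "q = 2")
  case True
  then show ?thesis using linked_base_involution[OF n x(1)] x(2) by simp
next
  case False
  then have odd: "odd q" using q(1) prime_odd_nat[of q] prime_gt_1_nat[of q] by linarith
  have xS: "x \<in> Sn n" using x by (simp add: PV_iff)
  have in_n: "i \<in> {1..n}" if "x i \<noteq> i" for i using xS that unfolding Sn_def permutes_def by blast
  obtain a where a: "x a \<noteq> a" using x(1) by (auto simp: PV_iff fun_eq_iff)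
  let ?O = "{(x ^^ k) a | k. True}"
  have O: "card ?O = q"
    using card_orbit[OF xS] least_power_prime[OF xS x(2) q(1) a] by simp
  show ?thesis
  proof (cases "\<exists>b. b \<notin> ?O \<and> x b \<noteq> b")
    case True
    then obtain b where b: "b \<notin> ?O" "x b \<noteq> b" by metis
    have "least_power x a = least_power x b"
      using least_power_prime[OF xS x(2) q(1)] a b by simp
    then obtain t where "t \<in> PV n" "t ^^ 2 = id" "linked n x t"
      using linked_involution_two_orbits[OF x odd in_n[OF a] in_n[OF b(2)]] b(1) by blast
    then show ?thesis using linked_base_involution[OF n] linked_trans by metis
  next
    case False
    have "finite ?O" by (rule card_ge_0_finite) (use O prime_gt_0_nat[OF q(1)] in simp)
    then obtain ys where ys: "distinct ys" "length ys = 2" "set ys \<subseteq> {1..n}" "set ys \<inter> ?O = {}"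
      using ex_points_outside[of ?O 2 n] O q(2) by auto
    then obtain u v where uv: "ys = [u, v]"
      by (metis (no_types, opaque_lifting) Suc_1 length_0_conv length_Suc_conv One_nat_def)
    then have "u \<notin> ?O" "v \<notin> ?O" using ys(4) by auto
    then have "x u = u" "x v = v" using False by metis+
    then show ?thesis
      by (intro linked_base_odd[OF n x odd, of u v]) (use ys uv in auto)
  qed
qed

lemma linked_base:
  assumes n: "n \<ge> 8" and p: "prime p" "n = p \<or> n = p + 1"
    and x: "x \<in> PV n" "\<not> p dvd perm_ord x"
  shows "linked n x base"
proof -
  have xS: "x \<in> Sn n" "x \<noteq> id" using x by (simp_all add: PV_iff)
  then have "perm_ord x \<noteq> 1" using perm_ord_eq_1 by blast
  then obtain q where q: "prime q" "q dvd perm_ord x" using prime_factor_nat by blast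
  have "q \<noteq> p" using q x(2) by auto
  \<comment> \<open>With \<open>k\<close> the order divided by \<open>q\<close>, the power
    \<open>x ^^ k\<close> has order \<open>q\<close>.\<close>
  obtain k where k: "perm_ord x = k * q" using q(2) by (metis dvdE mult.commute)
  have "k > 0" using k perm_ord_pow_eq_id(1)[OF xS(1)] by (intro gr0I) simp
  have "\<not> perm_ord x dvd k" using k \<open>k > 0\<close> prime_gt_1_nat[OF q(1)] by (auto dest!: dvd_imp_le)
  then have "x ^^ k \<noteq> id" using perm_ord_dvd_iff[OF xS(1)] by simp
  then have y: "x ^^ k \<in> PV n" using Sn_funpow[OF xS(1)] by (simp add: PV_iff)
  have yq: "(x ^^ k) ^^ q = id" using perm_ord_pow_eq_id(2)[OF xS(1)] k by (simp add: funpow_mult)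
  have "q + 2 \<le> n"
  proof -
    obtain a where a: "(x ^^ k) a \<noteq> a" using y by (auto simp: PV_iff fun_eq_iff)
    have "a \<in> {1..n}" using y a unfolding PV_iff Sn_def permutes_def by blast
    have yS: "x ^^ k \<in> Sn n" using y by (simp add: PV_iff)
    \<comment> \<open>An orbit of size \<open>q\<close> gives \<open>q \<le> n\<close>; parity then
      improves this to \<open>q + 2 \<le> n\<close>, where \<open>q = 2\<close> is covered by the
      lower bound on \<open>n\<close>.\<close>
    have "q = card {((x ^^ k) ^^ i) a | i. True}"
      using card_orbit[OF yS] least_power_prime[OF yS yq q(1) a] by simp
    also have "\<dots> \<le> card {1..n}"
      by (rule card_mono) (use funpow_in_interval[OF yS \<open>a \<in> {1..n}\<close>] in blast)+
    finally have "q \<le> n" by simp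
    moreover have "odd p" using p n prime_odd_nat[OF p(1)] by auto
    moreover have "q = 2 \<or> odd q" using prime_odd_nat[OF q(1)] prime_gt_1_nat[OF q(1)] by linarith
    ultimately show ?thesis using p(2) n \<open>q \<noteq> p\<close> by presburger
  qed
  then have "linked n (x ^^ k) base" using linked_base_prime[OF n y yq q(1)] by simp
  moreover have "linked n x (x ^^ k)"
    using \<open>k > 0\<close> by (intro linked_PE x(1) y PE_funpow) simp
  ultimately show ?thesis using linked_trans by metis
qed

section \<open>The \<open>p\<close>-cycles\<close>

lemma perm_ord_is_pcycle:
  assumes x: "x \<in> Sn n" and "is_pcycle n p x"
  shows "perm_ord x = p"
proof -
  have "x ^^ k = id \<longleftrightarrow> p dvd k" for k
    using assms(2) by (auto simp: funpow_eq_id_iff_cycle_type[OF x] is_pcycle_def)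
  then have "perm_ord x dvd k \<longleftrightarrow> p dvd k" for k using perm_ord_dvd_iff[OF x] by simp
  then show ?thesis by (meson dvd_antisym dvd_refl)
qed

text \<open>With \<open>k\<close> the order divided by \<open>p\<close>, some cycle length
  \<open>m\<close> divides \<open>k * p\<close> but not \<open>k\<close>, so \<open>p\<close>
  divides \<open>m\<close>. Since \<open>2 * p\<close> exceeds \<open>n\<close>, this forces
  \<open>m = p\<close>, and at most one point is left over, which is fixed.\<close>

lemma is_pcycle_of_dvd:
  assumes n: "n \<ge> 8" and p: "prime p" "n = p \<or> n = p + 1"
    and x: "x \<in> Sn n" "p dvd perm_ord x"
  shows "is_pcycle n p x"
proof -
  obtain k where k: "perm_ord x = k * p" using x(2) by (metis dvdE mult.commute)
  have "k > 0" using k perm_ord_pow_eq_id(1)[OF x(1)] by (intro gr0I) simp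
  then have "\<not> perm_ord x dvd k" using k prime_gt_1_nat[OF p(1)] by (auto dest!: dvd_imp_le)
  then have "x ^^ k \<noteq> id" using perm_ord_dvd_iff[OF x(1)] by simp
  then obtain m where m: "m \<in># cycle_type n x" "\<not> m dvd k"
    using funpow_eq_id_iff_cycle_type[OF x(1)] by blast
  have "x ^^ (k * p) = id" using perm_ord_pow_eq_id(2)[OF x(1)] k by simp
  then have "m dvd k * p" using m(1) funpow_eq_id_iff_cycle_type[OF x(1)] by blast
  have "p dvd m"
  proof (rule ccontr)
    assume "\<not> p dvd m"
    then have "coprime p m" using p(1) by (intro prime_imp_coprime)
    then have "coprime m p" by (rule coprime_commute[THEN iffD1])
    then show False using \<open>m dvd k * p\<close> m(2) by (simp add: coprime_dvd_mult_left_iff)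
  qed
  obtain T where T: "cycle_type n x = add_mset m T" using m(1) by (metis multi_member_split)
  then have sum: "m + sum_mset T = n" using sum_cycle_type[OF x(1)] by simp
  have "m \<noteq> 0" using m(1) cycle_type_pos[OF x(1)] by (intro notI) simp
  have "m = p"
  proof -
    obtain j where j: "m = p * j" using \<open>p dvd m\<close> by blast
    have "j < 2"
    proof (rule ccontr)
      assume "\<not> j < 2"
      then have "p * 2 \<le> m" unfolding j by (intro mult_le_mono2) simp
      then show False using sum p(2) n by linarith
    qed
    moreover have "j \<noteq> 0" using j \<open>m \<noteq> 0\<close> by (intro notI) simp
    ultimately have "j = 1" by linarith
    then show ?thesis using j by simp
  qed
  have "\<forall>i\<in>#T. i = 1"
  proof
    fix i assume i: "i \<in># T"
    then obtain U where "T = add_mset i U" by (metis multi_member_split)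
    then have "i \<le> sum_mset T" by simp
    moreover have "i \<noteq> 0" using i T cycle_type_pos[OF x(1)] by (intro notI) simp
    ultimately show "i = 1" using sum p(2) \<open>m = p\<close> by linarith
  qed
  then have "T = replicate_mset (sum_mset T) 1" by (simp only: all_ones_iff)
  moreover have "sum_mset T = n - p" using sum \<open>m = p\<close> by linarith
  ultimately show ?thesis using T \<open>m = p\<close> by (simp add: is_pcycle_def)
qed

text \<open>The two parts are told apart by orders and not by cycle types, as orders are what can be
  compared across all four graphs. For the \<open>n\<close> and \<open>p\<close> at hand,
  \<open>is_pcycle_of_dvd\<close> and \<open>perm_ord_is_pcycle\<close> identify
  \<open>p_part\<close> with the set of \<open>p\<close>-cycles.\<close>

definition main_part :: "nat \<Rightarrow> nat \<Rightarrow> (nat \<Rightarrow> nat) set" where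
  "main_part n p = {x \<in> PV n. perm_ord x \<noteq> p}"

definition p_part :: "nat \<Rightarrow> nat \<Rightarrow> (nat \<Rightarrow> nat) set" where
  "p_part n p = {x \<in> PV n. perm_ord x = p}"

lemma PV_split: "PV n = main_part n p \<union> p_part n p"
  by (auto simp: main_part_def p_part_def)

lemma p_part_PV: "x \<in> p_part n p \<Longrightarrow> x \<in> PV n" and main_part_PV: "x \<in> main_part n p \<Longrightarrow> x \<in> PV n"
  by (auto simp: main_part_def p_part_def)

lemma p_part_Sn: "x \<in> p_part n p \<Longrightarrow> x \<in> Sn n"
  by (auto simp: p_part_def PV_def)

text \<open>The moved points are those of least power \<open>p\<close>, and the length
  \<open>p\<close> occurs exactly once in the cycle type.\<close>

lemma moved_p_part:
  assumes n: "n \<ge> 8" and p: "prime p" "n = p \<or> n = p + 1" and x: "x \<in> p_part n p"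
  shows "card {a \<in> {1..n}. x a \<noteq> a} = p"
proof -
  have xS: "x \<in> Sn n" "perm_ord x = p" using x by (auto simp: p_part_def PV_def)
  have xp: "x ^^ p = id" using perm_ord_pow_eq_id(2)[OF xS(1)] xS(2) by simp
  have "least_power x a = p \<longleftrightarrow> x a \<noteq> a" for a
  proof
    assume "least_power x a = p"
    then have "\<not> least_power x a dvd 1" using prime_gt_1_nat[OF p(1)] by simp
    then show "x a \<noteq> a" using least_power_dvd_iff[OF xS(1), of a 1] by simp
  qed (rule least_power_prime[OF xS(1) xp p(1)])
  then have "card {a \<in> {1..n}. x a \<noteq> a} = count (point_type n x) p"
    by (simp add: count_point_type)
  also have "\<dots> = p * count (cycle_type n x) p" by (rule count_cycle_type[OF xS(1), symmetric])
  also have "count (cycle_type n x) p = 1"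
    using is_pcycle_of_dvd[OF n p xS(1)] xS(2) prime_gt_1_nat[OF p(1)] by (simp add: is_pcycle_def)
  finally show ?thesis by simp
qed

text \<open>A pair of a \<open>p\<close>-cycle and a point moved by it is the same as a list of \<open>p\<close> distinct points.\<close>

lemma card_p_part:
  assumes n: "n \<ge> 8" and p: "prime p" "n = p \<or> n = p + 1"
  shows "card (p_part n p) * p = fact n"
proof -
  let ?M = "\<lambda>x. {a \<in> {1..n}. x a \<noteq> a}"
  define S where "S = Sigma (p_part n p) ?M"
  define L where "L = {xs. length xs = p \<and> distinct xs \<and> set xs \<subseteq> {1..n}}"
  have p1: "p > 1" using prime_gt_1_nat[OF p(1)] .
  have "bij_betw (\<lambda>(x, a). support x a) S L"
  \<comment> \<open>\<open>support x a\<close> lists the cycle of \<open>a\<close> starting at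
    \<open>a\<close>, so the inverse map recovers the marked point as the head of the list.\<close>
  proof (rule bij_betw_byWitness[where f' = "\<lambda>xs. (cycle_of_list xs, xs ! 0)"])
    have *: "support x a \<in> L \<and> cycle_of_list (support x a) = x \<and> support x a ! 0 = a"
      if xa: "x \<in> p_part n p" "a \<in> {1..n}" "x a \<noteq> a" for x a
    proof -
      have xS: "x \<in> Sn n" "perm_ord x = p" using xa(1) by (auto simp: p_part_def PV_def)
      have xp: "x ^^ p = id" using perm_ord_pow_eq_id(2)[OF xS(1)] xS(2) by simp
      have perm: "permutation x" by (rule Sn_permutation[OF xS(1)])
      have lp: "least_power x a = p" by (rule least_power_prime[OF xS(1) xp p(1) xa(3)])
      have len: "length (support x a) = p" using lp by simp
      have dist: "distinct (support x a)" by (rule cycle_of_permutation[OF perm])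
      have "set (support x a) \<subseteq> ?M x"
      proof
        fix b assume "b \<in> set (support x a)"
        then obtain k where k: "b = (x ^^ k) a" unfolding support_set[OF perm] by blast
        have "x b \<noteq> b"
          using xa(3) Sn_inj[OF Sn_funpow[OF xS(1)], of k] unfolding k funpow_swap1 by (simp add: inj_eq)
        then show "b \<in> ?M x" using funpow_in_interval[OF xS(1) xa(2)] k by simp
      qed
      moreover have "card (set (support x a)) = card (?M x)"
        using distinct_card[OF dist] len moved_p_part[OF n p xa(1)] by simp
      ultimately have set: "set (support x a) = ?M x" by (intro card_subset_eq) simp_all
      have "cycle_of_list (support x a) b = x b" for b
      proof (cases "b \<in> set (support x a)")
        case True
        then show ?thesis by (rule cycle_restrict[OF perm, symmetric])
      next
        case False
        then have "x b = b" using set xS(1) unfolding Sn_def permutes_def by blast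
        then show ?thesis using id_outside_supp[OF False] by simp
      qed
      then have "cycle_of_list (support x a) = x" by blast
      moreover have "support x a \<in> L" using len dist set unfolding L_def by blast
      moreover have "support x a ! 0 = a" using lp p1 by simp
      ultimately show ?thesis by blast
    qed
    show "\<forall>z\<in>S. (case case z of (x, a) \<Rightarrow> support x a of xs \<Rightarrow> (cycle_of_list xs, xs ! 0)) = z"
      using * unfolding S_def by fastforce
    show "(\<lambda>(x, a). support x a) ` S \<subseteq> L"
      using * unfolding S_def by fastforce
    have **: "cycle_of_list xs \<in> p_part n p \<and> xs ! 0 \<in> ?M (cycle_of_list xs)
        \<and> support (cycle_of_list xs) (xs ! 0) = xs"
      if "xs \<in> L" for xs
    proof -
      have xs: "length xs = p" "distinct xs" "set xs \<subseteq> {1..n}" using that by (auto simp: L_def)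
      have mem: "xs ! 0 \<in> set xs" using xs(1) p1 by simp
      have lp: "least_power (cycle_of_list xs) (xs ! 0) = p"
        using least_power_cycle_of_list[OF xs(2) mem] xs(1) by simp
      have PV: "cycle_of_list xs \<in> PV n" by (rule cycle_of_list_PV) (use xs p1 in auto)
      then have "perm_ord (cycle_of_list xs) = p"
        using cycle_of_list_funpow_length[OF xs(2)] xs(1)
        by (intro perm_ord_prime[of _ n, OF _ p(1)]) (simp_all add: PV_iff)
      then have "cycle_of_list xs \<in> p_part n p" using PV by (simp add: p_part_def)
      moreover have "cycle_of_list xs (xs ! 0) \<noteq> xs ! 0"
      proof
        assume "cycle_of_list xs (xs ! 0) = xs ! 0"
        then have "least_power (cycle_of_list xs) (xs ! 0) dvd 1"
          by (subst least_power_dvd[OF permutation_of_cycle]) simp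
        then show False using lp p1 by simp
      qed
      moreover have "support (cycle_of_list xs) (xs ! 0) = xs"
      proof (rule nth_equalityI)
        fix i assume "i < length (support (cycle_of_list xs) (xs ! 0))"
        then have "i < p" using lp by simp
        then show "support (cycle_of_list xs) (xs ! 0) ! i = xs ! i"
          using funpow_cycle_of_list[OF xs(2), of 0 i] xs(1) lp p1 by simp
      qed (use lp xs in simp)
      ultimately show ?thesis using mem xs(3) by blast
    qed
    show "\<forall>xs\<in>L. (case (cycle_of_list xs, xs ! 0) of (x, a) \<Rightarrow> support x a) = xs"
      using ** by simp
    show "(\<lambda>xs. (cycle_of_list xs, xs ! 0)) ` L \<subseteq> S"
      using ** unfolding S_def by blast
  qed
  then have "card S = card L" by (rule bij_betw_same_card)
  also have "card L = \<Prod>{card {1..n} - p + 1 .. card {1..n}}"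
    unfolding L_def by (rule card_lists_distinct_length_eq) (use p in auto)
  \<comment> \<open>The product starts at 1 or at 2, so at most the factor 1 of the factorial is
    missing.\<close>
  also have "\<dots> = fact n"
  proof (cases "n = p")
    case False
    then have "n = p + 1" using p by simp
    moreover have "{1..n} = insert 1 {2..n}" using n by auto
    then have "\<Prod>{1..n} = \<Prod>{2..n}" by simp
    moreover have "card {1..n} - p + 1 = 2" "card {1..n} = n" using \<open>n = p + 1\<close> by simp_all
    ultimately show ?thesis by (simp only: fact_prod of_nat_id)
  qed (simp add: fact_prod)
  also have "card S = card (p_part n p) * p"
  proof -
    have "finite (p_part n p)" using finite_Sn[of n] by (rule rev_finite_subset) (auto intro: p_part_Sn)
    then have "card S = (\<Sum>x\<in>p_part n p. card (?M x))" unfolding S_def by (intro card_SigmaI) auto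
    also have "\<dots> = (\<Sum>x\<in>p_part n p. p)" using moved_p_part[OF n p] by (intro sum.cong) auto
    finally show ?thesis by simp
  qed
  finally show ?thesis .
qed

section \<open>Classes of p-cycles generating the same subgroup\<close>

lemma mem_cls: "x \<in> Sn n \<Longrightarrow> x \<in> cls n x"
  by (simp add: cls_def)

lemma cls_eqI: "y \<in> cls n x \<Longrightarrow> cls n y = cls n x"
  by (auto simp: cls_def)

lemma cls_p_part:
  assumes "x \<in> p_part n p" "prime p"
  shows "cls n x = (\<lambda>k. x ^^ k) ` {1..<p}" "card (cls n x) = p - 1" "cls n x \<subseteq> p_part n p"
proof -
  have x: "x \<in> Sn n" "perm_ord x = p" using assms(1) by (auto simp: p_part_def PV_def)
  show "cls n x = (\<lambda>k. x ^^ k) ` {1..<p}" "card (cls n x) = p - 1"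
    using cls_prime_order[OF x(1) assms(2) x(2)] by auto
  show "cls n x \<subseteq> p_part n p"
  proof
    fix y assume "y \<in> cls n x"
    then have y: "y \<in> Sn n" "cyc y = cyc x" by (auto simp: cls_def)
    then have "perm_ord y = p" using cyc_eq_perm_ord[OF x(1)] x(2) by simp
    moreover have "y \<noteq> id" using calculation perm_ord_eq_1[OF y(1)] prime_gt_1_nat[OF assms(2)] by auto
    ultimately show "y \<in> p_part n p" using y(1) by (simp add: p_part_def PV_iff)
  qed
qed

text \<open>A non-trivial power in a group of prime order is again a generator.\<close>

lemma p_part_PE_cls:
  assumes "x \<in> p_part n p" "y \<in> p_part n p" "prime p" "PE x y"
  shows "cls n x = cls n y"
proof -
  have *: "cls n (x ^^ k) = cls n x" if x: "x \<in> p_part n p" and y: "x ^^ k \<in> p_part n p" for x k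
  proof -
    have xS: "x \<in> Sn n" "perm_ord x = p" using x by (auto simp: p_part_def PV_def)
    then have "x ^^ p = id" using perm_ord_pow_eq_id(2)[OF xS(1)] by simp
    then have k: "x ^^ k = x ^^ (k mod p)" by (rule funpow_mod_of_id)
    have "x ^^ k \<noteq> id" using y by (simp add: p_part_def PV_iff)
    then have "k mod p \<noteq> 0" using k by (intro notI) simp
    then have "k mod p \<in> {1..<p}" using prime_gt_0_nat[OF assms(3)] by simp
    then have "x ^^ k \<in> cls n x" unfolding cls_p_part(1)[OF x assms(3)] k by (rule imageI)
    then show ?thesis by (rule cls_eqI)
  qed
  show ?thesis using assms(1,2,4) * unfolding PE_def ppow_def by metis
qed

text \<open>The classes partition the \<open>p\<close>-cycles into sets of size
  \<open>p - 1\<close>, so \<open>card_p_part\<close> makes their number times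
  \<open>(p - 1) * p\<close> equal to \<open>fact n\<close>.\<close>

lemma card_cls_p_part:
  assumes n: "n \<ge> 8" and p: "prime p" "n = p \<or> n = p + 1"
  shows "card (cls n ` p_part n p) = (if n = p then fact (n - 2) else n * fact (n - 3))"
proof -
  have fin: "finite (p_part n p)" using finite_Sn[of n] by (rule rev_finite_subset) (auto intro: p_part_Sn)
  have union: "\<Union>(cls n ` p_part n p) = p_part n p"
  proof
    show "\<Union>(cls n ` p_part n p) \<subseteq> p_part n p" using cls_p_part(3)[OF _ p(1)] by (rule UN_least)
    show "p_part n p \<subseteq> \<Union>(cls n ` p_part n p)" using mem_cls[OF p_part_Sn] by (intro subsetI UN_I)
  qed
  have "(p - 1) * card (cls n ` p_part n p) = card (\<Union>(cls n ` p_part n p))"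
  proof (rule card_partition)
    fix C D assume "C \<in> cls n ` p_part n p" "D \<in> cls n ` p_part n p" "C \<noteq> D"
    then obtain x y where xy: "C = cls n x" "D = cls n y" by (elim imageE)
    show "C \<inter> D = {}"
    proof (rule ccontr)
      assume "C \<inter> D \<noteq> {}"
      then obtain z where "z \<in> cls n x" "z \<in> cls n y" unfolding xy by blast
      then have "cls n x = cls n y" using cls_eqI[of z n x] cls_eqI[of z n y] by simp
      then show False using xy \<open>C \<noteq> D\<close> by simp
    qed
  qed (use fin union cls_p_part(2)[OF _ p(1)] in auto)
  then have "(p - 1) * card (cls n ` p_part n p) = card (p_part n p)" by (simp only: union)
  then have "(p - 1) * card (cls n ` p_part n p) * p = fact n" using card_p_part[OF n p] by simp
  then have c: "card (cls n ` p_part n p) * ((p - 1) * p) = fact n" by (simp only: ac_simps)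
  obtain q where q: "p = Suc (Suc q)"
    using prime_ge_2_nat[OF p(1)] by (metis add_2_eq_Suc le_Suc_ex)
  have fp: "fact p = fact (p - 2) * ((p - 1) * p)" by (simp add: q algebra_simps)
  have pos: "(p - 1) * p > 0" by (simp add: q)
  show ?thesis
  proof (cases "n = p")
    case True
    then show ?thesis using c fp pos by simp
  next
    case False
    then have np: "n = Suc p" using p by simp
    then have "n - 3 = p - 2" "fact n = n * fact p" by simp_all
    then have "fact n = (n * fact (n - 3)) * ((p - 1) * p)" using fp by (simp only: mult.assoc)
    then have "card (cls n ` p_part n p) = n * fact (n - 3)" using c pos by (metis mult_cancel2 not_gr0)
    then show ?thesis using False by simp
  qed
qed

section \<open>Quotients of the power graph\<close>

text \<open>A divisor of \<open>p\<close> is 1 or \<open>p\<close>, both excluded for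
  \<open>x\<close>. A multiple of \<open>p\<close> would make \<open>x\<close> a
  \<open>p\<close>-cycle, again of order \<open>p\<close>.\<close>

lemma not_OE_main_p:
  assumes n: "n \<ge> 8" and p: "prime p" "n = p \<or> n = p + 1"
    and x: "x \<in> main_part n p" and y: "y \<in> p_part n p"
  shows "\<not> OE (perm_ord x) (perm_ord y)"
proof
  have x': "x \<in> Sn n" "perm_ord x \<noteq> p" "x \<noteq> id" and y': "perm_ord y = p"
    using x y by (auto simp: main_part_def p_part_def PV_def)
  assume "OE (perm_ord x) (perm_ord y)"
  then consider "perm_ord x dvd p" | "p dvd perm_ord x" using y' by (auto simp: OE_def)
  then show False
  proof cases
    case 1
    then show False using x' p(1) perm_ord_eq_1[OF x'(1)] by (auto simp: prime_nat_iff)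
  next
    case 2
    then show False using is_pcycle_of_dvd[OF n p x'(1)] perm_ord_is_pcycle[OF x'(1)] x'(2) by blast
  qed
qed

lemma linked_main_part:
  assumes n: "n \<ge> 8" and p: "prime p" "n = p \<or> n = p + 1"
    and x: "x \<in> main_part n p" and y: "y \<in> main_part n p"
  shows "linked n x y"
proof -
  have "linked n z base" if "z \<in> main_part n p" for z
  proof -
    have z: "z \<in> PV n" "z \<in> Sn n" "perm_ord z \<noteq> p" using that by (auto simp: main_part_def PV_def)
    then have "\<not> p dvd perm_ord z" using is_pcycle_of_dvd[OF n p] perm_ord_is_pcycle by blast
    then show ?thesis by (rule linked_base[OF n p z(1)])
  qed
  then show ?thesis using x y linked_trans linked_sym by metis
qed

lemma cycle_of_list_main_part:
  assumes "distinct xs" "prime (length xs)" "set xs \<subseteq> {1..n}" "length xs \<noteq> p"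
  shows "cycle_of_list xs \<in> main_part n p" "perm_ord (cycle_of_list xs) = length xs"
proof -
  have "length xs \<ge> 2" using prime_ge_2_nat[OF assms(2)] .
  then have PV: "cycle_of_list xs \<in> PV n" by (intro cycle_of_list_PV assms)
  then show "perm_ord (cycle_of_list xs) = length xs"
    using cycle_of_list_funpow_length[OF assms(1)] assms(2)
    by (intro perm_ord_prime[of _ n]) (auto simp: PV_iff)
  then show "cycle_of_list xs \<in> main_part n p" using PV assms(4) by (simp add: main_part_def)
qed

lemma base_main_part:
  assumes "n \<ge> 8" "n = p \<or> n = p + 1"
  shows "base \<in> main_part n p" "perm_ord base = 2"
proof -
  have len: "length [1, 2 :: nat] = 2" by simp
  show "base \<in> main_part n p" "perm_ord base = 2"
    using cycle_of_list_main_part[of "[1, 2]" n p] assms unfolding base_eq len by auto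
qed

text \<open>Edges map forward, which carries paths over to the image. Backwards only comparability
  of orders is asked, since an edge of the image need not lift: 2 divides 6, but an element of order
  2 need not be a power of a given element of order 6.\<close>

definition order_quotient :: "nat \<Rightarrow> 'b set \<Rightarrow> ('b \<Rightarrow> 'b \<Rightarrow> bool) \<Rightarrow> ((nat \<Rightarrow> nat) \<Rightarrow> 'b) \<Rightarrow> bool" where
  "order_quotient n V E h \<longleftrightarrow> V = h ` PV n \<and>
     (\<forall>x\<in>PV n. \<forall>y\<in>PV n. PE x y \<longrightarrow> E (h x) (h y)) \<and>
     (\<forall>x\<in>PV n. \<forall>y\<in>PV n. E (h x) (h y) \<longrightarrow> OE (perm_ord x) (perm_ord y))"

lemma order_quotientI:
  assumes "V = h ` PV n"
    and "\<And>x y. x \<in> PV n \<Longrightarrow> y \<in> PV n \<Longrightarrow> PE x y \<Longrightarrow> E (h x) (h y)"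
    and "\<And>x y. x \<in> PV n \<Longrightarrow> y \<in> PV n \<Longrightarrow> E (h x) (h y) \<Longrightarrow> OE (perm_ord x) (perm_ord y)"
  shows "order_quotient n V E h"
  unfolding order_quotient_def using assms by simp

text \<open>All four graphs are images \<open>h\<close> of the power graph in which adjacent vertices still have
  comparable element orders; this is all that is needed to find the main component.\<close>

lemma quotient_components:
  fixes h :: "(nat \<Rightarrow> nat) \<Rightarrow> 'b"
  assumes n: "n \<ge> 8" and p: "prime p" "n = p \<or> n = p + 1"
    and quotient: "order_quotient n V E h"
  shows "x \<in> main_part n p \<Longrightarrow> component_of V E (h x) = h ` main_part n p"
    and "x \<in> p_part n p \<Longrightarrow> component_of V E (h x) \<subseteq> h ` p_part n p"
    and "x \<in> PV n \<Longrightarrow> h x \<in> h ` main_part n p \<longleftrightarrow> x \<in> main_part n p"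
    and "h ` main_part n p \<in> components V E"
    and "components V E - {h ` main_part n p} = (\<lambda>x. component_of V E (h x)) ` p_part n p"
    and "\<not> complete_on (h ` main_part n p) E"
proof -
  let ?M = "main_part n p" and ?P = "p_part n p"
  have V: "V = h ` PV n"
    and edge: "\<And>x y. x \<in> PV n \<Longrightarrow> y \<in> PV n \<Longrightarrow> PE x y \<Longrightarrow> E (h x) (h y)"
    and ord: "\<And>x y. x \<in> PV n \<Longrightarrow> y \<in> PV n \<Longrightarrow> E (h x) (h y) \<Longrightarrow> OE (perm_ord x) (perm_ord y)"
    using quotient by (simp_all add: order_quotient_def)
  have OE_sym: "OE i j \<Longrightarrow> OE j i" for i j by (auto simp: OE_def)
  have no_edge: "\<not> E (h x) (h y)" "\<not> E (h y) (h x)" if "x \<in> ?M" "y \<in> ?P" for x y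
    using not_OE_main_p[OF n p that] ord that OE_sym main_part_PV p_part_PV by metis+
  \<comment> \<open>\<open>E\<close> holds on the diagonal because \<open>x\<close> is its own first
    power. A missing edge therefore also shows that two images differ.\<close>
  have refl: "E (h x) (h x)" if "x \<in> PV n" for x
    using edge[OF that that] PE_funpow[of 1 x] by simp
  have neq: "h x \<noteq> h y" if "x \<in> ?M" "y \<in> ?P" for x y
    using no_edge[OF that] refl[OF main_part_PV[OF that(1)]] by metis
  \<comment> \<open>A set of preimages that no \<open>E\<close>-step leaves traps every path
    starting in its image; it is applied to both parts.\<close>
  have stay: "component_of V E (h x) \<subseteq> h ` A"
    if "x \<in> A" and A: "A \<subseteq> PV n" "\<And>u v. u \<in> A \<Longrightarrow> v \<in> PV n \<Longrightarrow> E (h u) (h v) \<Longrightarrow> v \<in> A" for x A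
  proof
    fix y assume "y \<in> component_of V E (h x)"
    then have "(adj V E)\<^sup>*\<^sup>* (h x) y" by (simp add: component_of_def)
    then show "y \<in> h ` A"
    proof (induction rule: rtranclp_induct)
      case base
      then show ?case using that(1) by blast
    next
      case (step y z)
      then obtain u where u: "u \<in> A" "y = h u" by blast
      have "z \<in> V" "E y z" using step(2) by (auto simp: adj_def)
      then obtain v where "v \<in> PV n" "z = h v" using V by blast
      then show ?case using A(2)[OF u(1)] u(2) \<open>E y z\<close> by blast
    qed
  qed
  have lift: "(adj V E)\<^sup>*\<^sup>* (h x) (h y)" if "linked n x y" for x y
    using that unfolding linked_def
  proof (induction rule: rtranclp_induct)
    case (step y z)
    then have yz: "y \<in> PV n" "z \<in> PV n" "PE y z" by (auto simp: adj_def)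
    show ?case
    \<comment> \<open>Adjacency excludes equal vertices, so an edge collapsed by \<open>h\<close> is
      dropped from the path.\<close>
    proof (cases "h y = h z")
      case True
      then show ?thesis using step(3) by simp
    next
      case False
      then have "adj V E (h y) (h z)" using yz edge V by (simp add: adj_def)
      with step(3) show ?thesis by (rule rtranclp.rtrancl_into_rtrancl)
    qed
  qed simp
  show main: "component_of V E (h x) = h ` ?M" if x: "x \<in> ?M" for x
  proof
    show "component_of V E (h x) \<subseteq> h ` ?M"
      using no_edge PV_split[of n p] by (intro stay[OF x]) blast+
    show "h ` ?M \<subseteq> component_of V E (h x)"
      using lift linked_main_part[OF n p x] by (auto simp: component_of_def)
  qed
  show "component_of V E (h x) \<subseteq> h ` ?P" if x: "x \<in> ?P" for x
    using no_edge PV_split[of n p] by (intro stay[OF x]) blast+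
  show "h x \<in> h ` ?M \<longleftrightarrow> x \<in> ?M" if "x \<in> PV n" for x
  proof
    assume "h x \<in> h ` ?M"
    then obtain y where "y \<in> ?M" "h x = h y" by (elim imageE)
    then have "x \<notin> ?P" using neq[of y x] by auto
    then show "x \<in> ?M" using that by (simp add: PV_split[of n p])
  qed (rule imageI)
  note base = base_main_part[OF n p(2)]
  show "h ` ?M \<in> components V E"
    unfolding components_def V using main[OF base(1)] main_part_PV[OF base(1)] V by blast
  have not_main: "component_of V E (h x) \<noteq> h ` ?M" if "x \<in> ?P" for x
  proof -
    have "h x \<in> component_of V E (h x)" by (simp add: component_of_def)
    moreover have "h x \<notin> h ` ?M" using neq[OF _ that] by (metis imageE)
    ultimately show ?thesis by blast
  qed
  have "components V E = (\<lambda>x. component_of V E (h x)) ` ?M \<union> (\<lambda>x. component_of V E (h x)) ` ?P"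
    unfolding components_def by (subst (2) V) (simp add: PV_split[of n p] image_Un image_image)
  also have "(\<lambda>x. component_of V E (h x)) ` ?M = {h ` ?M}" using main base(1) by auto
  finally have split: "components V E = {h ` ?M} \<union> (\<lambda>x. component_of V E (h x)) ` ?P" .
  have "h ` ?M \<notin> (\<lambda>x. component_of V E (h x)) ` ?P" using not_main by (metis imageE)
  then show "components V E - {h ` ?M} = (\<lambda>x. component_of V E (h x)) ` ?P"
    unfolding split by simp
  have c3: "cycle_of_list [1, 2, 3] \<in> ?M" "perm_ord (cycle_of_list [1, 2, 3 :: nat]) = 3"
  proof -
    have len: "length [1, 2, 3 :: nat] = 3" by simp
    have "prime (3 :: nat)" by simp
    then show "cycle_of_list [1, 2, 3] \<in> ?M" "perm_ord (cycle_of_list [1, 2, 3 :: nat]) = 3"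
      using cycle_of_list_main_part[of "[1, 2, 3]" n p] n p(2) unfolding len by auto
  qed
  have "\<not> OE (perm_ord base) (perm_ord (cycle_of_list [1, 2, 3 :: nat]))"
    unfolding base(2) c3(2) by (simp add: OE_def)
  then have "\<not> E (h base) (h (cycle_of_list [1, 2, 3]))"
    using ord main_part_PV base(1) c3(1) by metis
  moreover from this have "h base \<noteq> h (cycle_of_list [1, 2, 3])"
    using refl[OF main_part_PV[OF base(1)]] by metis
  ultimately show "\<not> complete_on (h ` ?M) E"
    using base(1) c3(1) unfolding complete_on_def by blast
qed

section \<open>The four graphs as images of the power graph\<close>

lemma OE_perm_ord:
  assumes "x \<in> Sn n" "y \<in> Sn n" "PE x y"
  shows "OE (perm_ord x) (perm_ord y)"
  using assms perm_ord_funpow_dvd unfolding PE_def ppow_def OE_def by metis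

lemma OV_eq: "OV n = perm_ord ` PV n"
  unfolding OV_def PV_def using perm_ord_eq_1[of _ n] by auto

lemma QV_eq: "QV n = cls n ` PV n"
  by (simp add: QV_def PV_def)

lemma QE_cls:
  assumes "x \<in> PV n" "y \<in> PV n" "PE x y"
  shows "QE (cls n x) (cls n y)"
  using assms mem_cls[of x n] mem_cls[of y n] unfolding QE_def PE_def PV_iff by blast

lemma QE_clsD:
  assumes "QE (cls n x) (cls n y)"
  obtains x' y' where "x' \<in> cls n x" "y' \<in> cls n y" "PE x' y'"
  using assms unfolding QE_def PE_def by blast

lemma QE_OE:
  assumes "x \<in> PV n" "y \<in> PV n" "QE (cls n x) (cls n y)"
  shows "OE (perm_ord x) (perm_ord y)"
proof -
  obtain x' y' where *: "x' \<in> cls n x" "y' \<in> cls n y" "PE x' y'" using assms(3) by (rule QE_clsD)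
  then have "perm_ord x' = perm_ord x" "perm_ord y' = perm_ord y" "x' \<in> Sn n" "y' \<in> Sn n"
    using assms(1,2) cyc_eq_perm_ord[of x n x'] cyc_eq_perm_ord[of y n y'] by (auto simp: cls_def PV_iff)
  then show ?thesis using OE_perm_ord[of x' n y'] *(3) by simp
qed

lemma TE_cycle_type:
  assumes "x \<in> PV n" "y \<in> PV n" "PE x y"
  shows "TE (cycle_type n x) (cycle_type n y)"
  using assms cycle_type_funpow unfolding TE_def PE_def ppow_def PV_iff by metis

text \<open>An edge only says that one permutation has the type of some power of the other, without
  being such a power. This suffices because the order depends on the type alone.\<close>

lemma TE_OE:
  assumes "x \<in> PV n" "y \<in> PV n" "TE (cycle_type n x) (cycle_type n y)"
  shows "OE (perm_ord x) (perm_ord y)"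
proof -
  have *: "perm_ord v dvd perm_ord u"
    if "u \<in> Sn n" "v \<in> Sn n" "cycle_type n v = ppower (cycle_type n u) a" for u v a
  proof -
    have "cycle_type n v = cycle_type n (u ^^ a)" using that cycle_type_funpow by simp
    then have "perm_ord v = perm_ord (u ^^ a)"
      by (rule cycle_type_eq_perm_ord[OF that(2) Sn_funpow[OF that(1)]])
    then show ?thesis using perm_ord_funpow_dvd[OF that(1)] by simp
  qed
  show ?thesis using assms * unfolding TE_def OE_def PV_iff by metis
qed

text \<open>A neighbour of a \<open>p\<close>-cycle has comparable order, so it is a
  \<open>p\<close>-cycle too and generates the same subgroup. Conversely every member of the class
  is a positive power of \<open>x\<close>.\<close>

lemma component_PV_p_part:
  assumes n: "n \<ge> 8" and p: "prime p" "n = p \<or> n = p + 1" and x: "x \<in> p_part n p"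
  shows "component_of (PV n) PE x = cls n x"
proof (intro equalityI subsetI)
  fix y assume "y \<in> component_of (PV n) PE x"
  then have "(adj (PV n) PE)\<^sup>*\<^sup>* x y" by (simp add: component_of_def)
  then show "y \<in> cls n x"
  proof (induction rule: rtranclp_induct)
    case base
    then show ?case using x by (intro mem_cls p_part_Sn)
  next
    case (step y z)
    have y: "y \<in> p_part n p" using step(3) cls_p_part(3)[OF x p(1)] by blast
    have z: "z \<in> PV n" "PE y z" using step(2) by (auto simp: adj_def)
    have "z \<in> Sn n" using z(1) by (simp add: PV_iff)
    then have "OE (perm_ord z) (perm_ord y)"
      using p_part_Sn[OF y] PE_sym[OF z(2)] by (rule OE_perm_ord)
    then have "z \<notin> main_part n p" using not_OE_main_p[OF n p _ y] by metis
    then have "z \<in> p_part n p" using z(1) by (simp add: PV_split[of n p])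
    then have "cls n z = cls n y" using p_part_PE_cls[OF y _ p(1) z(2)] by simp
    then show ?case using step(3) cls_eqI mem_cls[of z n] z(1) unfolding PV_iff by metis
  qed
next
  fix y assume y: "y \<in> cls n x"
  then have "y \<in> PV n" using cls_p_part(3)[OF x p(1)] p_part_PV by blast
  moreover obtain k where "k \<ge> 1" "y = x ^^ k" using y cls_p_part(1)[OF x p(1)] by auto
  ultimately have "linked n x y" using linked_PE[OF p_part_PV[OF x]] PE_funpow by metis
  then show "y \<in> component_of (PV n) PE x" by (simp add: linked_def component_of_def)
qed

lemma complete_cls_p_part:
  assumes x: "x \<in> p_part n p" and p: "prime p"
  shows "complete_on (cls n x) PE"
  unfolding complete_on_def
proof (intro ballI impI)
  fix y z assume y: "y \<in> cls n x" and z: "z \<in> cls n x"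
  have "y \<in> p_part n p" using y cls_p_part(3)[OF x p] by blast
  from cls_p_part(1)[OF this p] have "z \<in> (\<lambda>k. y ^^ k) ` {1..<p}" using z cls_eqI[OF y] by simp
  then show "PE y z" using PE_funpow by auto
qed

text \<open>Representatives joined by an edge generate the same subgroup, so a neighbouring class
  would be the class itself. The hypothesis \<open>sub\<close> is the confinement to
  \<open>p\<close>-cycles supplied by \<open>quotient_components\<close>.\<close>

lemma component_QV_p_part:
  assumes p: "prime p" and x: "x \<in> p_part n p"
    and sub: "\<And>x. x \<in> p_part n p \<Longrightarrow> component_of (QV n) QE (cls n x) \<subseteq> cls n ` p_part n p"
  shows "component_of (QV n) QE (cls n x) = {cls n x}"
proof (intro equalityI subsetI)
  fix Y assume "Y \<in> component_of (QV n) QE (cls n x)"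
  then have "(adj (QV n) QE)\<^sup>*\<^sup>* (cls n x) Y" by (simp add: component_of_def)
  then have "Y = cls n x"
  proof (induction rule: rtranclp_induct)
    case (step Y Z)
    then have a: "adj (QV n) QE (cls n x) Z" by simp
    then have "Z \<in> component_of (QV n) QE (cls n x)" by (auto simp: component_of_def)
    then obtain z where z: "z \<in> p_part n p" "Z = cls n z" using sub[OF x] by blast
    have "QE (cls n x) (cls n z)" using a z(2) by (simp add: adj_def)
    then obtain x' z' where *: "x' \<in> cls n x" "z' \<in> cls n z" "PE x' z'" by (rule QE_clsD)
    have "cls n x' = cls n z'"
      using * cls_p_part(3)[OF x p] cls_p_part(3)[OF z(1) p] by (intro p_part_PE_cls[OF _ _ p]) auto
    then have "Z = cls n x" using cls_eqI[OF *(1)] cls_eqI[OF *(2)] z(2) by simp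
    then show ?case .
  qed simp
  then show "Y \<in> {cls n x}" by simp
next
  fix Y assume "Y \<in> {cls n x}"
  then show "Y \<in> component_of (QV n) QE (cls n x)" by (simp add: component_of_def)
qed

theorem theoremD:
  fixes n p :: nat
  assumes "n \<ge> 8" and "prime p" and "n = p \<or> n = p + 1"
  defines "N \<equiv> (if n = p then fact (n - 2) else n * fact (n - 3) :: nat)"
      and "D2 \<equiv> {\<psi> \<in> Sn n - {id}. cls n \<psi> \<in> Delta n}"
      and "D3 \<equiv> {cycle_type n \<psi> | \<psi>. \<psi> \<in> Sn n - {id} \<and> cls n \<psi> \<in> Delta n}"
      and "D4 \<equiv> {perm_ord \<psi> | \<psi>. \<psi> \<in> Sn n - {id} \<and> cls n \<psi> \<in> Delta n}"
  shows
    \<comment> \<open>(i)\<close>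
    "(\<forall>\<psi>\<in>Sn n - {id}. \<not> is_pcycle n p \<psi> \<longrightarrow> cls n \<psi> \<in> Delta n)
     \<and> card (components (QV n) QE - {Delta n}) = N
     \<and> (\<forall>C\<in>components (QV n) QE - {Delta n}. card C = 1)
     \<and> \<not> complete_on (Delta n) QE
     \<comment> \<open>(ii)\<close>
     \<and> D2 \<in> components (PV n) PE
     \<and> (\<forall>\<psi>\<in>Sn n - {id}. \<not> is_pcycle n p \<psi> \<longrightarrow> \<psi> \<in> D2)
     \<and> card (components (PV n) PE - {D2}) = N
     \<and> (\<forall>C\<in>components (PV n) PE - {D2}.
          card C = p - 1 \<and> (\<forall>\<psi>\<in>C. is_pcycle n p \<psi>) \<and> complete_on C PE)
     \<and> \<not> complete_on D2 PE
     \<comment> \<open>(iii)\<close>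
     \<and> D3 \<in> components (TV n) TE
     \<and> (\<forall>\<psi>\<in>Sn n - {id}. \<not> is_pcycle n p \<psi> \<longrightarrow> cycle_type n \<psi> \<in> D3)
     \<and> components (TV n) TE - {D3} = {{if n = p then {#p#} else {#1, p#}}}
     \<and> \<not> complete_on D3 TE
     \<comment> \<open>(iv)\<close>
     \<and> D4 \<in> components (OV n) OE
     \<and> (\<forall>\<psi>\<in>Sn n - {id}. perm_ord \<psi> \<noteq> p \<longrightarrow> perm_ord \<psi> \<in> D4)
     \<and> components (OV n) OE - {D4} = {{p}}
     \<and> \<not> complete_on D4 OE"
proof -
  note n = assms(1) and p = assms(2,3)
  let ?M = "main_part n p" and ?P = "p_part n p"
  have PE_OE: "OE (perm_ord x) (perm_ord y)" if "x \<in> PV n" "y \<in> PV n" "PE x y" for x y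
    using that OE_perm_ord[of x n y] by (simp add: PV_iff)
  have "order_quotient n (QV n) QE (cls n)"
    by (rule order_quotientI) (fact QV_eq QE_cls QE_OE)+
  note Q = quotient_components[OF n p this]
  \<comment> \<open>The power graph is treated as its own quotient under the identity map.\<close>
  have "order_quotient n (PV n) PE (\<lambda>x. x)"
    by (rule order_quotientI) (simp, assumption, fact PE_OE)
  note P = quotient_components[OF n p this, unfolded image_ident]
  have "order_quotient n (TV n) TE (cycle_type n)"
    by (rule order_quotientI) (fact TV_eq TE_cycle_type TE_OE)+
  note T = quotient_components[OF n p this]
  have "order_quotient n (OV n) OE perm_ord"
    by (rule order_quotientI) (fact OV_eq, fact PE_OE, assumption)
  note O = quotient_components[OF n p this]
  have Delta: "Delta n = cls n ` ?M"
    using Q(1)[OF base_main_part(1)[OF n p(2)]] by (simp add: Delta_def base_def)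
  \<comment> \<open>The class of a non-identity permutation decides whether it lies in the main
    part, so the sets described through \<open>Delta n\<close> become that part and its
    images.\<close>
  have mem: "\<psi> \<in> Sn n - {id} \<and> cls n \<psi> \<in> Delta n \<longleftrightarrow> \<psi> \<in> ?M" for \<psi>
    using Q(3)[of \<psi>] main_part_PV[of \<psi> n p] unfolding Delta PV_def by blast
  have D2: "D2 = ?M" unfolding D2_def using mem by blast
  have D3: "D3 = cycle_type n ` ?M" unfolding D3_def using mem by blast
  have D4: "D4 = perm_ord ` ?M" unfolding D4_def using mem by blast
  have not_p: "\<psi> \<in> ?M" if "\<psi> \<in> Sn n - {id}" "\<not> is_pcycle n p \<psi>" for \<psi>
    using that is_pcycle_of_dvd[OF n p, of \<psi>] by (auto simp: main_part_def PV_def)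
  have P_pcycle: "is_pcycle n p \<psi>" if "\<psi> \<in> ?P" for \<psi>
    using that is_pcycle_of_dvd[OF n p, of \<psi>] by (auto simp: p_part_def PV_def)
  \<comment> \<open>The number of \<open>p\<close>-cycles times \<open>p\<close> is a factorial,
    hence nonzero.\<close>
  obtain c where c: "c \<in> ?P"
    using card_p_part[OF n p] by (metis all_not_in_conv card.empty fact_nonzero mult_0)
  have Q_comp: "components (QV n) QE - {Delta n} = (\<lambda>C. {C}) ` cls n ` ?P"
    unfolding Delta Q(5) using component_QV_p_part[OF p(1) _ Q(2)] by (simp add: image_image)
  have P_comp: "components (PV n) PE - {D2} = cls n ` ?P"
    unfolding D2 P(5) using component_PV_p_part[OF n p] by simp
  \<comment> \<open>All \<open>p\<close>-cycles share one type and one order. Where \<open>h\<close>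
    is constant on \<open>?P\<close>, its components collapse to one singleton, which is present
    because \<open>?P\<close> is nonempty.\<close>
  have single: "(\<lambda>x. component_of V E (h x)) ` ?P = {{v}}"
    if sub: "\<And>x. x \<in> ?P \<Longrightarrow> component_of V E (h x) \<subseteq> h ` ?P"
      and const: "\<And>x. x \<in> ?P \<Longrightarrow> h x = v"
    for V E and h :: "(nat \<Rightarrow> nat) \<Rightarrow> 'c" and v
  proof -
    have "component_of V E (h x) = {v}" if x: "x \<in> ?P" for x
    proof -
      have "h x \<in> component_of V E (h x)" by (simp add: component_of_def)
      moreover have "h ` ?P \<subseteq> {v}" using const by auto
      ultimately show ?thesis using sub[OF x] const[OF x] by (metis subset_antisym subset_trans empty_subsetI insert_subset)
    qed
    then show ?thesis using c by blast
  qed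
  have T_comp: "components (TV n) TE - {D3} = {{if n = p then {#p#} else {#1, p#}}}"
    unfolding D3 T(5)
    by (rule single[OF T(2)]) (use P_pcycle p(2) in \<open>auto simp: is_pcycle_def\<close>)
  have O_comp: "components (OV n) OE - {D4} = {{p}}"
    unfolding D4 O(5) by (rule single[OF O(2)]) (auto simp: p_part_def)
  have card_N: "card (cls n ` ?P) = N" unfolding N_def by (rule card_cls_p_part[OF n p])
  show ?thesis
  proof (intro conjI)
    show "\<forall>\<psi>\<in>Sn n - {id}. \<not> is_pcycle n p \<psi> \<longrightarrow> cls n \<psi> \<in> Delta n"
      using not_p Delta by blast
    show "card (components (QV n) QE - {Delta n}) = N"
      unfolding Q_comp by (subst card_image) (simp_all add: card_N)
    show "\<forall>C\<in>components (QV n) QE - {Delta n}. card C = 1" unfolding Q_comp by auto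
    show "\<not> complete_on (Delta n) QE" unfolding Delta by (rule Q(6))
    show "D2 \<in> components (PV n) PE" unfolding D2 by (rule P(4))
    show "\<forall>\<psi>\<in>Sn n - {id}. \<not> is_pcycle n p \<psi> \<longrightarrow> \<psi> \<in> D2" using not_p D2 by blast
    show "card (components (PV n) PE - {D2}) = N" unfolding P_comp by (rule card_N)
    show "\<forall>C\<in>components (PV n) PE - {D2}.
        card C = p - 1 \<and> (\<forall>\<psi>\<in>C. is_pcycle n p \<psi>) \<and> complete_on C PE"
      unfolding P_comp
      using cls_p_part(2,3)[OF _ p(1)] P_pcycle complete_cls_p_part[OF _ p(1)] by blast
    show "\<not> complete_on D2 PE" unfolding D2 by (rule P(6))
    show "D3 \<in> components (TV n) TE" unfolding D3 by (rule T(4))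
    show "\<forall>\<psi>\<in>Sn n - {id}. \<not> is_pcycle n p \<psi> \<longrightarrow> cycle_type n \<psi> \<in> D3" using not_p D3 by blast
    show "components (TV n) TE - {D3} = {{if n = p then {#p#} else {#1, p#}}}" by (rule T_comp)
    show "\<not> complete_on D3 TE" unfolding D3 by (rule T(6))
    show "D4 \<in> components (OV n) OE" unfolding D4 by (rule O(4))
    show "\<forall>\<psi>\<in>Sn n - {id}. perm_ord \<psi> \<noteq> p \<longrightarrow> perm_ord \<psi> \<in> D4"
      unfolding D4 main_part_def PV_def by blast
    show "components (OV n) OE - {D4} = {{p}}" by (rule O_comp)
    show "\<not> complete_on D4 OE" unfolding D4 by (rule O(6))
  qed
qed

end
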